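(* Let $\kappa$ be a cardinal with $\kappa>2^{\mathrm{cf}(\kappa)}>\mathrm{cf}(\kappa)>\omega$ and $2^\kappa=\kappa^+$. Then $\mathrm{ro}(\mathrm{sq}(\mathbb P(\omega^\kappa)))\cong\mathrm{Col}(\omega,2^\kappa)$.
   Context: Ordinal exponentiation: $\omega^\kappa=\kappa$ for such $\kappa$. $\mathbb P(\omega^\kappa)$ is the poset of subsets of $\omega^\kappa$ order-isomorphic to $\omega^\kappa$, ordered by $\subset$; $\mathrm{sq}$ is separative quotient; $\mathrm{ro}$ is Boolean completion; $\mathrm{Col}(\omega,\mu)$ is the Boolean completion of $\langle{}^{<\omega}\mu,\supset\rangle$. *)

theory Defs
  imports Main
begin

text \<open>Posets/preorders are given as a carrier set P together with an order relation le
  (le q p reads q is stronger than / below p).  The Boolean completion ro(P) is the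
  complete Boolean algebra of regular open subsets of P in the topology whose open sets
  are the downward closed sets, ordered by inclusion.\<close>

definition pos_int :: "'a set \<Rightarrow> ('a \<Rightarrow> 'a \<Rightarrow> bool) \<Rightarrow> 'a set \<Rightarrow> 'a set" where
  "pos_int P le S = {p \<in> P. \<forall>q\<in>P. le q p \<longrightarrow> q \<in> S}"

definition pos_cl :: "'a set \<Rightarrow> ('a \<Rightarrow> 'a \<Rightarrow> bool) \<Rightarrow> 'a set \<Rightarrow> 'a set" where
  "pos_cl P le S = {p \<in> P. \<exists>q\<in>P. q \<in> S \<and> le q p}"

definition regular_open :: "'a set \<Rightarrow> ('a \<Rightarrow> 'a \<Rightarrow> bool) \<Rightarrow> 'a set \<Rightarrow> bool" where
  "regular_open P le U \<longleftrightarrow> U \<subseteq> P \<and> U = pos_int P le (pos_cl P le U)"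

definition ro :: "'a set \<Rightarrow> ('a \<Rightarrow> 'a \<Rightarrow> bool) \<Rightarrow> 'a set set" where
  "ro P le = {U. regular_open P le U}"

text \<open>Isomorphism of the complete Boolean algebras (both ordered by inclusion):
  an order isomorphism, which is the same as a Boolean algebra isomorphism.\<close>
definition ba_iso :: "'a set set \<Rightarrow> 'b set set \<Rightarrow> bool" where
  "ba_iso A B \<longleftrightarrow> (\<exists>f. bij_betw f A B \<and> (\<forall>x\<in>A. \<forall>y\<in>A. x \<subseteq> y \<longleftrightarrow> f x \<subseteq> f y))"

definition compat :: "'a set \<Rightarrow> ('a \<Rightarrow> 'a \<Rightarrow> bool) \<Rightarrow> 'a \<Rightarrow> 'a \<Rightarrow> bool" where
  "compat P le p q \<longleftrightarrow> (\<exists>r\<in>P. le r p \<and> le r q)"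

definition sep_le :: "'a set \<Rightarrow> ('a \<Rightarrow> 'a \<Rightarrow> bool) \<Rightarrow> 'a \<Rightarrow> 'a \<Rightarrow> bool" where
  "sep_le P le p q \<longleftrightarrow> (\<forall>r\<in>P. le r p \<longrightarrow> compat P le r q)"

definition sq_carrier :: "'a set \<Rightarrow> ('a \<Rightarrow> 'a \<Rightarrow> bool) \<Rightarrow> 'a set set" where
  "sq_carrier P le = (\<lambda>p. {q \<in> P. sep_le P le p q \<and> sep_le P le q p}) ` P"

definition sq_le :: "'a set \<Rightarrow> ('a \<Rightarrow> 'a \<Rightarrow> bool) \<Rightarrow> 'a set \<Rightarrow> 'a set \<Rightarrow> bool" where
  "sq_le P le A B \<longleftrightarrow> (\<exists>p\<in>A. \<exists>q\<in>B. sep_le P le p q)"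

text \<open>The cardinal kappa is represented by a cardinal well-order r on a type 'k
  (so omega^kappa = kappa is the order type of r).  P(omega^kappa): subsets of the field
  of r order-isomorphic to r, ordered by inclusion.\<close>
definition P_omega_kappa :: "'k rel \<Rightarrow> 'k set set" where
  "P_omega_kappa r = {X. X \<subseteq> Field r \<and> (Restr r X, r) \<in> ordIso}"

text \<open>Col(omega,mu): finite sequences in mu, s below t iff s extends t.\<close>
definition col_le :: "'b list \<Rightarrow> 'b list \<Rightarrow> bool" where
  "col_le s t \<longleftrightarrow> (\<exists>u. s = t @ u)"

definition cofinal :: "'k rel \<Rightarrow> 'k set \<Rightarrow> bool" where
  "cofinal r C \<longleftrightarrow> C \<subseteq> Field r \<and> (\<forall>a\<in>Field r. \<exists>b\<in>C. (a, b) \<in> r)"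

text \<open>C witnesses the cofinality: a cofinal subset of minimal cardinality, so |C| = cf(kappa).\<close>
definition cof_witness :: "'k rel \<Rightarrow> 'k set \<Rightarrow> bool" where
  "cof_witness r C \<longleftrightarrow> cofinal r C \<and> (\<forall>D. cofinal r D \<longrightarrow> (card_of C, card_of D) \<in> ordLeq)"

end

theory Submission
  imports Defs
begin

text \<open>
  Call a subset of \<open>\<kappa>\<close> small if its cardinality is below \<open>\<kappa>\<close> and big otherwise;
  the big sets are exactly the elements of \<open>P(\<omega>\<^sup>\<kappa>)\<close>, and two of them are incompatible iff
  their intersection is small. Since the cofinality of \<open>\<kappa>\<close> is uncountable, every big set can be
  thinned out along a tree of length \<open>\<omega>\<close>: below each node there is an almost increasing tower of
  length \<open>\<kappa>\<^sup>+ = 2\<^sup>\<kappa>\<close> of sets which carry a ranking into the cofinality, and the rankings drop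
  strictly along branches. As they cannot drop forever, a big set that met fewer than \<open>cf(\<kappa>)\<close>
  members of each tower would be a countable union of small sets. Hence it meets \<open>cf(\<kappa>)\<close> many
  members of some tower, and a transversal through them sits in a filtered position from which
  almost disjoint refinements can be built by recursion. So the big sets have a refinement which
  splits into countably many almost disjoint pieces, one for each length of a node.
  This makes the forcing collapse \<open>2\<^sup>\<kappa>\<close> to \<open>\<omega>\<close>: choosing maximal almost disjoint families of
  size \<open>2\<^sup>\<kappa>\<close> that decide one piece after the other yields a dense copy of the tree of finite
  sequences in \<open>2\<^sup>\<kappa>\<close>.
\<close>

section \<open>Small sets and a filtration along the cofinality\<close>

unbundle cardinal_syntax

section \<open>Comparison of cardinalities\<close>

lemma card_of_diff_not_le:
  assumes "\<not> finite B" and "\<not> |A| \<le>o |B|" and "|D| \<le>o |B|"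
  shows "\<not> |A - D| \<le>o |B|"
proof
  assume "|A - D| \<le>o |B|"
  then have "|(A - D) \<union> D| \<le>o |B|"
    using assms by (intro card_of_Un_ordLeq_infinite_Field) (simp_all only: Field_card_of card_of_card_order_on not_False_eq_True)
  moreover have "|A| \<le>o |(A - D) \<union> D|" by (rule card_of_mono1) auto
  ultimately show False using assms(2) ordLeq_transitive by blast
qed

lemma card_not_le_iff: "\<not> |A| \<le>o |B| \<longleftrightarrow> |B| <o |A|"
  using not_ordLeq_iff_ordLess[OF card_of_Well_order card_of_Well_order] .

lemma obtain_subset_of_card:
  assumes "\<not> |A| \<le>o |B|"
  obtains W where "W \<subseteq> A" "|W| =o |B|"
proof -
  have "|B| \<le>o |A|"
    using assms card_not_le_iff ordLess_imp_ordLeq by blast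
  then obtain W where "W \<subseteq> A" "|B| =o |W|"
    using internalize_card_of_ordLeq2[of B A] by blast
  then show ?thesis using that[of W] ordIso_symmetric[of "|B|" "|W|"] by simp
qed

lemma card_le_subset: "A \<subseteq> B \<Longrightarrow> |B| \<le>o p \<Longrightarrow> |A| \<le>o p"
  using card_of_mono1 ordLeq_transitive by blast

definition small :: "'k set \<Rightarrow> bool" where
  "small A \<longleftrightarrow> |A| <o |UNIV :: 'k set|"

lemma small_subset: "small B \<Longrightarrow> A \<subseteq> B \<Longrightarrow> small A"
  unfolding small_def using card_of_mono1 ordLeq_ordLess_trans by blast

text \<open>
  \<open>\<sqsubseteq>\<close> well-orders \<open>C\<close> in order type \<open>cf(\<kappa>)\<close>, \<open>F\<close> is an increasing filtration of \<open>\<kappa>\<close> by small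
  sets, and \<open>\<prec>\<close> well-orders the power set of \<open>\<kappa>\<close> in order type \<open>\<kappa>\<^sup>+\<close>. In this way subsets
  of \<open>\<kappa>\<close> double as ordinals below \<open>\<kappa>\<^sup>+\<close>, so that every subset is handled at its own stage of
  a recursion of length \<open>\<kappa>\<^sup>+\<close>.
\<close>

locale singular_filtration =
  fixes C :: "'k set"
    and le :: "'k \<Rightarrow> 'k \<Rightarrow> bool"  (infix "\<sqsubseteq>" 50)
    and F :: "'k \<Rightarrow> 'k set"
    and lt :: "'k set \<Rightarrow> 'k set \<Rightarrow> bool"  (infix "\<prec>" 50)
  assumes le_refl: "a \<in> C \<Longrightarrow> a \<sqsubseteq> a"
    and le_trans: "a \<sqsubseteq> b \<Longrightarrow> b \<sqsubseteq> c \<Longrightarrow> a \<sqsubseteq> c"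
    and le_total: "a \<in> C \<Longrightarrow> b \<in> C \<Longrightarrow> a \<sqsubseteq> b \<or> b \<sqsubseteq> a"
    and le_antisym: "a \<sqsubseteq> b \<Longrightarrow> b \<sqsubseteq> a \<Longrightarrow> a = b"
    and le_wellorder: "D \<subseteq> C \<Longrightarrow> D \<noteq> {} \<Longrightarrow> \<exists>m\<in>D. \<forall>d\<in>D. m \<sqsubseteq> d"
    and le_initial: "a \<in> C \<Longrightarrow> |{b\<in>C. b \<sqsubseteq> a}| <o |C|"
    and C_regular: "D \<subseteq> C \<Longrightarrow> |D| <o |C| \<Longrightarrow> \<exists>a\<in>C. \<forall>d\<in>D. d \<sqsubseteq> a"
    and C_uncountable: "|UNIV :: nat set| <o |C|"
    and F_mono: "a \<sqsubseteq> b \<Longrightarrow> F a \<subseteq> F b"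
    and F_small: "a \<in> C \<Longrightarrow> small (F a)"
    and F_ge: "a \<in> C \<Longrightarrow> |C| \<le>o |F a|"
    and F_cover: "(\<Union>a\<in>C. F a) = UNIV"
    and lt_wf: "wf {(x, y). x \<prec> y}"
    and lt_trans: "x \<prec> y \<Longrightarrow> y \<prec> z \<Longrightarrow> x \<prec> z"
    and lt_total: "x \<prec> y \<or> x = y \<or> y \<prec> x"
    and lt_initial: "|{x. x \<prec> y}| \<le>o |UNIV :: 'k set|"
    and lt_bounded: "|A :: 'k set set| \<le>o |UNIV :: 'k set| \<Longrightarrow> \<exists>y. \<forall>x\<in>A. x \<prec> y"
    and lt_sequence: "|C| \<le>o |A| \<Longrightarrow>
      \<exists>g. (\<forall>c\<in>C. g c \<in> A) \<and> (\<forall>b\<in>C. \<forall>c\<in>C. b \<sqsubseteq> c \<longrightarrow> b \<noteq> c \<longrightarrow> g b \<prec> g c)"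
begin

section \<open>The levels of the filtration as a scale of sizes\<close>

lemma C_infinite: "\<not> finite C"
  using C_uncountable ordLess_imp_ordLeq card_of_ordLeq_finite infinite_UNIV_nat by blast

lemma C_nonempty: "C \<noteq> {}"
  using C_infinite by auto

lemma F_infinite: "a \<in> C \<Longrightarrow> \<not> finite (F a)"
  using C_infinite F_ge card_of_ordLeq_infinite by blast

lemma small_if_le_F: "a \<in> C \<Longrightarrow> |A| \<le>o |F a| \<Longrightarrow> small (A :: 'k set)"
  using F_small ordLeq_ordLess_trans unfolding small_def by blast

lemma UN_le_F:
  assumes "a \<in> C" "|I| \<le>o |F a|" "\<And>i. i \<in> I \<Longrightarrow> |A i| \<le>o |F a|"
  shows "|\<Union>i\<in>I. A i| \<le>o |F a|"
  using assms F_infinite card_of_UNION_ordLeq_infinite[of "F a" I A] by blast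

lemma initial_le_F: "a \<in> C \<Longrightarrow> b \<in> C \<Longrightarrow> |{c\<in>C. c \<sqsubseteq> b}| \<le>o |F a|"
  using le_initial F_ge ordLess_imp_ordLeq ordLeq_transitive by blast

lemma F_le_mono: "a \<sqsubseteq> b \<Longrightarrow> |F a| \<le>o |F b|"
  using F_mono card_of_mono1 by blast

lemma UN_initial_le_F:
  assumes "a \<in> C" "\<And>j. j \<in> C \<Longrightarrow> |W j| \<le>o |F j|"
  shows "|\<Union>j\<in>{j\<in>C. j \<sqsubseteq> a}. W j| \<le>o |F a|"
proof (rule UN_le_F[OF assms(1) initial_le_F[OF assms(1,1)]])
  fix j assume "j \<in> {j\<in>C. j \<sqsubseteq> a}"
  then show "|W j| \<le>o |F a|"
    using assms(2) F_le_mono ordLeq_transitive[of "|W j|" "|F j|" "|F a|"] by simp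
qed

text \<open>If no level dominated \<open>A\<close>, the levels, at most \<open>|A|\<close> in
  number, would all have size at most \<open>|A|\<close>, and so would their union, which is
  everything.\<close>

lemma small_bound:
  fixes A :: "'k set"
  assumes "small A"
  obtains a where "a \<in> C" "|A| \<le>o |F a|"
proof (rule ccontr)
  assume "\<not> thesis"
  then have "\<not> |A| \<le>o |F a|" if "a \<in> C" for a
    using that \<open>\<And>a. \<lbrakk>a \<in> C; |A| \<le>o |F a|\<rbrakk> \<Longrightarrow> thesis\<close> by blast
  then have lt: "|F a| \<le>o |A|" if "a \<in> C" for a
    using that card_not_le_iff ordLess_imp_ordLeq by blast
  obtain a where a: "a \<in> C" using C_nonempty by blast
  have "\<not> finite A" using lt[OF a] F_infinite[OF a] card_of_ordLeq_infinite by blast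
  moreover have "|C| \<le>o |A|" using lt[OF a] F_ge[OF a] ordLeq_transitive by blast
  ultimately have "|\<Union>a\<in>C. F a| \<le>o |A|" using lt card_of_UNION_ordLeq_infinite[of A C F] by blast
  then show False using assms not_ordLess_ordLeq[of "|A|"] unfolding small_def F_cover by auto
qed

text \<open>A level of maximal size would bound the size of the union of all levels, because there
  are no more levels than it has points; but it is small.\<close>

lemma F_unbounded:
  assumes "a \<in> C"
  obtains b where "b \<in> C" "a \<sqsubseteq> b" "|F a| <o |F b|"
proof -
  have "\<exists>b\<in>C. |F a| <o |F b|"
  proof (rule ccontr)
    assume "\<not> ?thesis"
    then have "|F b| \<le>o |F a|" if "b \<in> C" for b
      using that card_not_le_iff[of "F b" "F a"] by blast
    then have "|\<Union>b\<in>C. F b| \<le>o |F a|" using UN_le_F[OF assms F_ge[OF assms]] by blast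
    then show False using F_small[OF assms] not_ordLess_ordLeq[of "|F a|"] unfolding small_def F_cover by auto
  qed
  then obtain b where b: "b \<in> C" "|F a| <o |F b|" by blast
  then have "\<not> b \<sqsubseteq> a" using F_le_mono not_ordLess_ordLeq by blast
  then show ?thesis using that b le_total assms by blast
qed

text \<open>Regularity of \<open>C\<close> gives one level that dominates all the bounds from
  \<open>small_bound\<close>, as well as the number of sets.\<close>

lemma small_UN:
  fixes A :: "'i \<Rightarrow> 'k set"
  assumes "|I| <o |C|" "\<And>i. i \<in> I \<Longrightarrow> small (A i)"
  shows "small (\<Union>i\<in>I. A i)"
proof -
  have "\<exists>a\<in>C. |A i| \<le>o |F a|" if "i \<in> I" for i
    using small_bound[OF assms(2)[OF that]] by blast
  then obtain h where h: "\<And>i. i \<in> I \<Longrightarrow> h i \<in> C \<and> |A i| \<le>o |F (h i)|" by metis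
  have "|h ` I| <o |C|" using card_of_image ordLeq_ordLess_trans assms(1) by blast
  then obtain a where a: "a \<in> C" "\<forall>d\<in>h ` I. d \<sqsubseteq> a" using C_regular[of "h ` I"] h by blast
  have "|A i| \<le>o |F a|" if "i \<in> I" for i
    using h[OF that] a that F_le_mono ordLeq_transitive by blast
  moreover have "|I| \<le>o |F a|" using assms(1) F_ge[OF a(1)] ordLess_imp_ordLeq ordLeq_transitive by blast
  ultimately show ?thesis using UN_le_F[OF a(1)] small_if_le_F[OF a(1)] by blast
qed

lemma finite_less_C: "finite I \<Longrightarrow> |I| <o |C|"
  using C_infinite card_of_ordLeq_finite card_not_le_iff by blast

lemma countable_small_UN: "(\<And>n :: nat. small (A n :: 'k set)) \<Longrightarrow> small (\<Union>n. A n)"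
  by (rule small_UN[OF C_uncountable])

lemma small_Un: "small (A :: 'k set) \<Longrightarrow> small B \<Longrightarrow> small (A \<union> B)"
proof -
  assume *: "small A" "small B"
  have "small (\<Union>b\<in>{True, False}. if b then A else B)"
    by (rule small_UN, rule finite_less_C) (simp_all add: * split: if_split)
  then show ?thesis by (simp add: Un_commute)
qed

lemma big_minus: "\<not> small (A :: 'k set) \<Longrightarrow> small B \<Longrightarrow> \<not> small (A - B)"
  using small_Un[of "A - B" B] small_subset[of "A - B \<union> B" A] by blast

lemma small_empty: "small ({} :: 'k set)"
  using small_subset F_small C_nonempty by blast

text \<open>Subsets as large as each level suffice, because the sizes of the levels have no maximum.
  The constructions below assemble big sets from small pieces in this way.\<close>

lemma bigI:
  fixes Y :: "'k set"
  assumes "\<And>j. j \<in> C \<Longrightarrow> \<exists>W\<subseteq>Y. |F j| \<le>o |W|"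
  shows "\<not> small Y"
proof
  assume "small Y"
  then obtain a where a: "a \<in> C" "|Y| \<le>o |F a|" by (rule small_bound)
  obtain b where b: "b \<in> C" "|F a| <o |F b|" using F_unbounded[OF a(1)] by blast
  obtain W where "W \<subseteq> Y" "|F b| \<le>o |W|" using assms[OF b(1)] by blast
  then have "|F b| \<le>o |F a|" using card_le_subset[OF _ a(2)] ordLeq_transitive by blast
  then show False using not_ordLess_ordLeq[OF b(2)] by blast
qed

lemma big_not_le_F: "\<not> small (Y :: 'k set) \<Longrightarrow> a \<in> C \<Longrightarrow> \<not> |Y| \<le>o |F a|"
  using small_if_le_F by blast

lemma exists_F: obtains a where "a \<in> C" "x \<in> F a"
  using F_cover by blast

section \<open>Towers of ranked sets\<close>

text \<open>A ranking encodes, by its sublevel sets, a filtration of \<open>X\<close> of length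
  cf(\<kappa>) that grows no faster than \<open>F\<close>.\<close>

definition ranked :: "'k set \<Rightarrow> ('k \<Rightarrow> 'k) \<Rightarrow> bool" where
  "ranked X \<rho> \<longleftrightarrow> (\<forall>y\<in>X. \<rho> y \<in> C) \<and> (\<forall>a\<in>C. |{y\<in>X. \<rho> y \<sqsubseteq> a}| \<le>o |F a| )"

text \<open>The strict drop of the rank is what later excludes a point lying on an infinite
  branch.\<close>

definition deeper :: "'k set \<Rightarrow> ('k \<Rightarrow> 'k) \<Rightarrow> 'k set \<Rightarrow> ('k \<Rightarrow> 'k) \<Rightarrow> bool" where
  "deeper X \<rho> A \<sigma> \<longleftrightarrow> A \<subseteq> X \<and> ranked A \<sigma> \<and> (\<forall>y\<in>A. \<sigma> y \<sqsubseteq> \<rho> y \<and> \<sigma> y \<noteq> \<rho> y)"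

lemma ranked_in: "ranked X \<rho> \<Longrightarrow> y \<in> X \<Longrightarrow> \<rho> y \<in> C"
  by (simp add: ranked_def)

lemma ranked_le: "ranked X \<rho> \<Longrightarrow> a \<in> C \<Longrightarrow> |{y\<in>X. \<rho> y \<sqsubseteq> a}| \<le>o |F a|"
  by (simp add: ranked_def)

lemma small_ranked: "ranked A \<sigma> \<Longrightarrow> a \<in> C \<Longrightarrow> small {y\<in>A. \<sigma> y \<sqsubseteq> a}"
  using small_if_le_F ranked_le by simp

lemma deeperD:
  assumes "deeper X \<rho> A \<sigma>"
  shows "A \<subseteq> X" "ranked A \<sigma>" "y \<in> A \<Longrightarrow> \<sigma> y \<sqsubseteq> \<rho> y" "y \<in> A \<Longrightarrow> \<sigma> y \<noteq> \<rho> y"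
  using assms by (auto simp: deeper_def)

text \<open>Outside the sublevel set of \<open>\<rho>\<close> at \<open>j\<close>, the big set
  \<open>Y\<close> still has room for a piece \<open>W j\<close> of the size of \<open>F j\<close>.
  Points of \<open>W j\<close> have \<open>\<rho>\<close> above \<open>j\<close>, so labelling them
  with such a \<open>j\<close> gives a strictly smaller rank.\<close>

lemma obtain_deeper:
  assumes "ranked X \<rho>" "Y \<subseteq> X" "\<not> small Y"
  obtains A \<sigma> where "A \<subseteq> Y" "\<not> small A" "deeper X \<rho> A \<sigma>"
proof -
  have "\<exists>W \<subseteq> Y - {y\<in>X. \<rho> y \<sqsubseteq> j}. |W| =o |F j|" if j: "j \<in> C" for j
    using obtain_subset_of_card[OF card_of_diff_not_le[OF F_infinite[OF j]
        big_not_le_F[OF assms(3) j] ranked_le[OF assms(1) j]]] by metis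
  then obtain W where W: "\<And>j. j \<in> C \<Longrightarrow> W j \<subseteq> Y - {y\<in>X. \<rho> y \<sqsubseteq> j} \<and> |W j| =o |F j|"
    by metis
  define A where "A = (\<Union>j\<in>C. W j)"
  define \<sigma> where "\<sigma> y = (SOME j. j \<in> C \<and> y \<in> W j)" for y
  have \<sigma>: "\<sigma> y \<in> C \<and> y \<in> W (\<sigma> y)" if "y \<in> A" for y
    using that someI_ex[of "\<lambda>j. j \<in> C \<and> y \<in> W j"] unfolding A_def \<sigma>_def by blast
  have AY: "A \<subseteq> Y" unfolding A_def using W by blast
  have "\<not> small A"
  proof (rule bigI)
    fix j assume "j \<in> C"
    then have "W j \<subseteq> A" "|F j| \<le>o |W j|"
      using W[of j] unfolding A_def by (auto intro: ordIso_imp_ordLeq ordIso_symmetric)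
    then show "\<exists>W\<subseteq>A. |F j| \<le>o |W|" by blast
  qed
  moreover have "ranked A \<sigma>" unfolding ranked_def
  proof (intro conjI ballI)
    fix a assume a: "a \<in> C"
    have "{y\<in>A. \<sigma> y \<sqsubseteq> a} \<subseteq> (\<Union>j\<in>{j\<in>C. j \<sqsubseteq> a}. W j)" using \<sigma> by blast
    moreover have "|\<Union>j\<in>{j\<in>C. j \<sqsubseteq> a}. W j| \<le>o |F a|"
      by (rule UN_initial_le_F[OF a ordIso_imp_ordLeq]) (use W in blast)
    ultimately show "|{y\<in>A. \<sigma> y \<sqsubseteq> a}| \<le>o |F a|" by (rule card_le_subset)
  qed (use \<sigma> in blast)
  moreover have "\<sigma> y \<sqsubseteq> \<rho> y \<and> \<sigma> y \<noteq> \<rho> y" if y: "y \<in> A" for y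
  proof -
    have yX: "y \<in> X" using y AY assms(2) by blast
    then have "\<rho> y \<in> C" using ranked_in[OF assms(1)] by blast
    moreover have "\<not> \<rho> y \<sqsubseteq> \<sigma> y" using \<sigma>[OF y] W[of "\<sigma> y"] yX by blast
    ultimately show ?thesis using \<sigma>[OF y] le_total le_refl by metis
  qed
  ultimately show ?thesis using that[of A \<sigma>] AY assms(2) unfolding deeper_def by blast
qed

text \<open>A diagonal union along an injection of the indices into \<kappa>: up to rank
  \<open>a\<close>, at most \<open>|F a|\<close> indices contribute at most \<open>|F a|\<close>
  points each, and what is lost of \<open>A i\<close> lies in a single sublevel set of
  \<open>\<sigma> i\<close>.\<close>

lemma deeper_upper_bound:
  fixes I :: "'i set"
  assumes "|I| \<le>o |UNIV :: 'k set|" and "\<And>i. i \<in> I \<Longrightarrow> deeper X \<rho> (A i) (\<sigma> i)"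
  shows "\<exists>B \<tau>. deeper X \<rho> B \<tau> \<and> (\<forall>i\<in>I. small (A i - B))"
proof -
  obtain e :: "'i \<Rightarrow> 'k" where e: "inj_on e I"
    using assms(1) card_of_ordLeq[of I "UNIV :: 'k set"] by auto
  \<comment> \<open>Only those points of \<open>A i\<close> are kept whose rank has already reached the code of \<open>i\<close>.\<close>
  define Q where "Q y i \<longleftrightarrow> i \<in> I \<and> y \<in> A i \<and> e i \<in> F (\<sigma> i y)" for y i
  define B where "B = {y. \<exists>i. Q y i}"
  \<comment> \<open>A point kept on behalf of several indices takes its rank from one chosen among
    them.\<close>
  define w where "w y = (SOME i. Q y i)" for y
  define \<tau> where "\<tau> y = \<sigma> (w y) y" for y
  have w: "Q y (w y)" if "y \<in> B" for y
    using that someI_ex[of "Q y"] unfolding B_def w_def by blast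
  have \<tau>C: "\<tau> y \<in> C" if "y \<in> B" for y
    using w[OF that] deeperD(2)[OF assms(2), of "w y"] ranked_in unfolding Q_def \<tau>_def by blast
  have "ranked B \<tau>" unfolding ranked_def
  proof (intro conjI ballI)
    fix a assume a: "a \<in> C"
    let ?I = "{i\<in>I. e i \<in> F a}"
    have "{y\<in>B. \<tau> y \<sqsubseteq> a} \<subseteq> (\<Union>i\<in>?I. {y\<in>A i. \<sigma> i y \<sqsubseteq> a})"
    proof
      fix y assume y: "y \<in> {y\<in>B. \<tau> y \<sqsubseteq> a}"
      then have "Q y (w y)" using w by blast
      moreover have "\<sigma> (w y) y \<sqsubseteq> a" using y unfolding \<tau>_def by blast
      ultimately show "y \<in> (\<Union>i\<in>?I. {y\<in>A i. \<sigma> i y \<sqsubseteq> a})"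
        using F_mono unfolding Q_def by blast
    qed
    moreover have "|\<Union>i\<in>?I. {y\<in>A i. \<sigma> i y \<sqsubseteq> a}| \<le>o |F a|"
    proof (rule UN_le_F[OF a])
      have "inj_on e ?I" using e by (rule inj_on_subset) blast
      then show "|?I| \<le>o |F a|" using card_of_ordLeq[of ?I "F a"] by blast
      show "|{y\<in>A i. \<sigma> i y \<sqsubseteq> a}| \<le>o |F a|" if "i \<in> ?I" for i
        using that ranked_le[OF deeperD(2)[OF assms(2)] a] by simp
    qed
    ultimately show "|{y\<in>B. \<tau> y \<sqsubseteq> a}| \<le>o |F a|" by (rule card_le_subset)
  qed (use \<tau>C in blast)
  moreover have "B \<subseteq> X" using w deeperD(1)[OF assms(2)] unfolding Q_def by blast
  moreover have "\<tau> y \<sqsubseteq> \<rho> y \<and> \<tau> y \<noteq> \<rho> y" if "y \<in> B" for y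
    using w[OF that] deeperD(3,4)[OF assms(2), of "w y" y] unfolding Q_def \<tau>_def by blast
  ultimately have "deeper X \<rho> B \<tau>" unfolding deeper_def by blast
  moreover have "small (A i - B)" if i: "i \<in> I" for i
  proof -
    obtain c where c: "c \<in> C" "e i \<in> F c" by (rule exists_F)
    have "A i - B \<subseteq> {y\<in>A i. \<sigma> i y \<sqsubseteq> c}"
    proof
      fix y assume y: "y \<in> A i - B"
      then have "e i \<notin> F (\<sigma> i y)" "\<sigma> i y \<in> C"
        using i ranked_in[OF deeperD(2)[OF assms(2)[OF i]]] unfolding B_def Q_def by blast+
      then have "\<sigma> i y \<sqsubseteq> c" using c F_mono le_total by blast
      then show "y \<in> {y\<in>A i. \<sigma> i y \<sqsubseteq> c}" using y by blast
    qed
    then show ?thesis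
      by (rule small_subset[OF small_ranked[OF deeperD(2)[OF assms(2)[OF i]] c(1)]])
  qed
  ultimately show ?thesis by blast
qed

lemma deeper_empty: "deeper X \<rho> {} \<sigma>"
  unfolding deeper_def ranked_def by (simp add: card_of_empty)

text \<open>Stage \<open>\<gamma>\<close> absorbs the earlier stages, of which there are at most
  \<kappa>, and, if \<open>\<gamma>\<close> is itself a big subset of \<open>X\<close>, also a
  deeper big subset of \<open>\<gamma>\<close>.\<close>

lemma tower_exists:
  assumes "ranked X \<rho>"
  obtains T :: "'k set \<Rightarrow> 'k set \<times> ('k \<Rightarrow> 'k)" where
    "\<And>\<gamma>. deeper X \<rho> (fst (T \<gamma>)) (snd (T \<gamma>))"
    "\<And>\<xi> \<gamma>. \<xi> \<prec> \<gamma> \<Longrightarrow> small (fst (T \<xi>) - fst (T \<gamma>))"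
    "\<And>\<gamma>. \<gamma> \<subseteq> X \<Longrightarrow> \<not> small \<gamma> \<Longrightarrow> \<not> small (\<gamma> \<inter> fst (T \<gamma>))"
proof -
  define P where "P f \<gamma> t \<longleftrightarrow> deeper X \<rho> (fst t) (snd t) \<and>
      (\<forall>\<xi>. \<xi> \<prec> \<gamma> \<longrightarrow> small (fst (f \<xi>) - fst t)) \<and>
      (\<gamma> \<subseteq> X \<longrightarrow> \<not> small \<gamma> \<longrightarrow> \<not> small (\<gamma> \<inter> fst t))"
    for f :: "'k set \<Rightarrow> 'k set \<times> ('k \<Rightarrow> 'k)" and \<gamma> t
  have "\<exists>f. \<forall>\<gamma>. P f \<gamma> (f \<gamma>)"
  proof (rule dependent_wf_choice[OF lt_wf])
    fix \<gamma> f assume IH: "\<And>\<xi>. (\<xi>, \<gamma>) \<in> {(x, y). x \<prec> y} \<Longrightarrow> P f \<xi> (f \<xi>)"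
    have "\<And>\<xi>. \<xi> \<in> {\<xi>. \<xi> \<prec> \<gamma>} \<Longrightarrow> deeper X \<rho> (fst (f \<xi>)) (snd (f \<xi>))"
      using IH unfolding P_def by blast
    then obtain B \<tau> where B: "deeper X \<rho> B \<tau>" "\<And>\<xi>. \<xi> \<prec> \<gamma> \<Longrightarrow> small (fst (f \<xi>) - B)"
      using deeper_upper_bound[OF lt_initial, of \<gamma> X \<rho> "\<lambda>\<xi>. fst (f \<xi>)" "\<lambda>\<xi>. snd (f \<xi>)"] by blast
    obtain A \<sigma> where A: "deeper X \<rho> A \<sigma>" "\<gamma> \<subseteq> X \<Longrightarrow> \<not> small \<gamma> \<Longrightarrow> A \<subseteq> \<gamma> \<and> \<not> small A"
    proof (cases "\<gamma> \<subseteq> X \<and> \<not> small \<gamma>")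
      case True
      then show ?thesis using obtain_deeper[OF assms] that by metis
    next
      case False
      then show ?thesis using that[of "{}"] deeper_empty by blast
    qed
    \<comment> \<open>\<open>bool\<close> indexes the pair \<open>A\<close>, \<open>B\<close>, so
      that the upper bound lemma also joins these two.\<close>
    have two: "|UNIV :: bool set| \<le>o |UNIV :: 'k set|"
      by (rule ordLess_imp_ordLeq[OF ordLess_ordLeq_trans[OF finite_less_C card_of_mono1]]) simp_all
    have "deeper X \<rho> (if b then A else B) (if b then \<sigma> else \<tau>)" for b
      using A(1) B(1) by simp
    from deeper_upper_bound[OF two, of X \<rho> "\<lambda>b. if b then A else B" "\<lambda>b. if b then \<sigma> else \<tau>", OF this] obtain B' \<tau>' where B': "deeper X \<rho> B' \<tau>'"
        "\<And>b. small ((if b then A else B) - B')" by blast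
    have small': "small (A - B')" "small (B - B')" using B'(2)[of True] B'(2)[of False] by simp_all
    have "small (fst (f \<xi>) - B')" if "\<xi> \<prec> \<gamma>" for \<xi>
      by (rule small_subset[OF small_Un[OF B(2)[OF that] small'(2)]]) blast
    moreover have "\<not> small (\<gamma> \<inter> B')" if "\<gamma> \<subseteq> X" "\<not> small \<gamma>"
    proof -
      have "A \<subseteq> \<gamma>" "\<not> small A" using A(2) that by blast+
      then have "\<not> small (A - (A - B'))" "A - (A - B') \<subseteq> \<gamma> \<inter> B'"
        using big_minus[OF _ small'(1)] by blast+
      then show ?thesis using small_subset[of "\<gamma> \<inter> B'" "A - (A - B')"] by blast
    qed
    ultimately have "P f \<gamma> (B', \<tau>')" using B'(1) unfolding P_def by simp
    then show "\<exists>t. P f \<gamma> t" ..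
  qed (simp add: P_def)
  then show ?thesis using that unfolding P_def by blast
qed

section \<open>The tree of nodes and the sets orthogonal to a node\<close>

definition tower :: "'k set \<times> ('k \<Rightarrow> 'k) \<Rightarrow> ('k set \<Rightarrow> 'k set \<times> ('k \<Rightarrow> 'k)) \<Rightarrow> bool" where
  "tower x T \<longleftrightarrow>
    (\<forall>\<gamma>. deeper (fst x) (snd x) (fst (T \<gamma>)) (snd (T \<gamma>))) \<and>
    (\<forall>\<xi> \<gamma>. \<xi> \<prec> \<gamma> \<longrightarrow> small (fst (T \<xi>) - fst (T \<gamma>))) \<and>
    (\<forall>\<gamma>. \<gamma> \<subseteq> fst x \<longrightarrow> \<not> small \<gamma> \<longrightarrow> \<not> small (\<gamma> \<inter> fst (T \<gamma>)))"

text \<open>Nodes are read backwards: the head of the list is the most recent choice.\<close>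

primrec node :: "'k set list \<Rightarrow> 'k set \<times> ('k \<Rightarrow> 'k)" where
  "node [] = (UNIV, \<lambda>y. SOME a. a \<in> C \<and> y \<in> F a)"
| "node (\<gamma> # s) = (SOME T. tower (node s) T) \<gamma>"

abbreviation X :: "'k set list \<Rightarrow> 'k set" where "X s \<equiv> fst (node s)"
abbreviation rank :: "'k set list \<Rightarrow> 'k \<Rightarrow> 'k" where "rank s \<equiv> snd (node s)"

text \<open>A point is ranked at the root by some level that contains it, so the sublevel set at
  \<open>a\<close> is inside \<open>F a\<close>.\<close>

lemma ranked_root: "ranked (X []) (rank [])"
proof -
  have *: "rank [] y \<in> C \<and> y \<in> F (rank [] y)" for y
    using someI_ex[of "\<lambda>a. a \<in> C \<and> y \<in> F a"] exists_F[of y] by auto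
  show ?thesis unfolding ranked_def
  proof (intro conjI ballI)
    fix a assume "a \<in> C"
    have "{y \<in> X []. rank [] y \<sqsubseteq> a} \<subseteq> F a" using * F_mono by blast
    then show "|{y \<in> X []. rank [] y \<sqsubseteq> a}| \<le>o |F a|" by (rule card_of_mono1)
  qed (use * in blast)
qed

text \<open>The choice in \<open>node\<close> is meaningful once a tower exists, which needs a
  ranked node; the tower in turn makes the next node ranked. Hence towers are first obtained under
  the hypothesis of rankedness.\<close>

lemma ranked_node: "ranked (X s) (rank s)"
  and tower_node: "tower (node s) (\<lambda>\<gamma>. node (\<gamma> # s))"
proof -
  have tow: "tower (node s) (\<lambda>\<gamma>. node (\<gamma> # s))" if "ranked (X s) (rank s)" for s
  proof -
    have "\<exists>T. tower (node s) T"
      using tower_exists[OF that] unfolding tower_def by metis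
    from someI_ex[OF this] show ?thesis by simp
  qed
  show r: "ranked (X s) (rank s)" for s
  proof (induction s)
    case (Cons \<gamma> s)
    then show ?case using tow[OF Cons] unfolding tower_def by (blast dest: deeperD(2))
  qed (rule ranked_root)
  show "tower (node s) (\<lambda>\<gamma>. node (\<gamma> # s))" by (rule tow[OF r])
qed

lemma
  shows rank_Cons: "y \<in> X (\<gamma> # s) \<Longrightarrow> rank (\<gamma> # s) y \<sqsubseteq> rank s y"
      "y \<in> X (\<gamma> # s) \<Longrightarrow> rank (\<gamma> # s) y \<noteq> rank s y"
    and X_increasing: "\<xi> \<prec> \<gamma> \<Longrightarrow> small (X (\<xi> # s) - X (\<gamma> # s))"
    and X_hits: "\<gamma> \<subseteq> X s \<Longrightarrow> \<not> small \<gamma> \<Longrightarrow> \<not> small (\<gamma> \<inter> X (\<gamma> # s))"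
  using tower_node[of s] unfolding tower_def by (blast dest: deeperD)+

text \<open>For a big \<open>Z\<close>, each entry of the node is then the least index whose tower
  member meets \<open>Z\<close> in a big set, so \<open>Z\<close> is orthogonal to at most one node
  of each length.\<close>

primrec orth :: "'k set list \<Rightarrow> 'k set \<Rightarrow> bool" where
  "orth [] Z \<longleftrightarrow> True"
| "orth (\<gamma> # s) Z \<longleftrightarrow> orth s Z \<and> Z \<subseteq> X (\<gamma> # s) \<and> (\<forall>\<xi>. \<xi> \<prec> \<gamma> \<longrightarrow> small (Z \<inter> X (\<xi> # s)))"

lemma orth_mono: "orth s Z \<Longrightarrow> Z' \<subseteq> Z \<Longrightarrow> orth s Z'"
proof (induction s)
  case (Cons \<gamma> s)
  have "small (Z' \<inter> X (\<xi> # s))" if "\<xi> \<prec> \<gamma>" for \<xi>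
    using Cons.prems that small_subset[of "Z \<inter> X (\<xi> # s)" "Z' \<inter> X (\<xi> # s)"]
    by (auto simp del: node.simps)
  then show ?case using Cons by (auto simp del: node.simps)
qed simp

lemma orth_subset: "orth s Z \<Longrightarrow> Z \<subseteq> X s"
  by (cases s) auto

text \<open>At the earliest level where the nodes differ, the member with the smaller index contains
  one of the two sets and meets the other in a small set.\<close>

lemma orth_almost_disjoint:
  "length s = length s' \<Longrightarrow> s \<noteq> s' \<Longrightarrow> orth s Z \<Longrightarrow> orth s' Z' \<Longrightarrow> small (Z \<inter> Z')"
proof (induction s s' rule: list_induct2)
  case (Cons \<gamma> s \<gamma>' s')
  show ?case
  proof (cases "s = s'")
    case True
    then have "\<gamma> \<prec> \<gamma>' \<or> \<gamma>' \<prec> \<gamma>" using Cons.prems(1) lt_total by blast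
    then show ?thesis
    proof
      assume "\<gamma> \<prec> \<gamma>'"
      then have "small (Z' \<inter> X (\<gamma> # s))" using Cons.prems(3) True by simp
      then show ?thesis
        by (rule small_subset) (use Cons.prems(2) in \<open>auto simp del: node.simps\<close>)
    next
      assume "\<gamma>' \<prec> \<gamma>"
      then have "small (Z \<inter> X (\<gamma>' # s'))" using Cons.prems(2) True by simp
      then show ?thesis
        by (rule small_subset) (use Cons.prems(3) in \<open>auto simp del: node.simps\<close>)
    qed
  next
    case False
    then show ?thesis using Cons by simp
  qed
qed simp

lemma lt_least:
  assumes "Q x"
  obtains m where "Q m" "\<And>y. y \<prec> m \<Longrightarrow> \<not> Q y"
  using wfE_min[OF lt_wf, of x "{x. Q x}"] assms by (metis (no_types, lifting) case_prodI mem_Collect_eq)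

section \<open>Almost disjoint refinements\<close>

text \<open>A weakly increasing cofinal sequence of length cf(\<kappa>) in \<open>\<gamma>\<close>,
  viewed as an ordinal.\<close>

definition climbs :: "('k \<Rightarrow> 'k set) \<Rightarrow> 'k set \<Rightarrow> bool" where
  "climbs t \<gamma> \<longleftrightarrow> (\<forall>a\<in>C. t a \<prec> \<gamma>) \<and> (\<forall>a\<in>C. \<forall>b\<in>C. a \<sqsubseteq> b \<longrightarrow> t a = t b \<or> t a \<prec> t b) \<and>
    (\<forall>\<xi>. \<xi> \<prec> \<gamma> \<longrightarrow> (\<exists>a\<in>C. \<xi> = t a \<or> \<xi> \<prec> t a))"

text \<open>\<open>SOME\<close> is meaningful only when \<open>\<gamma>\<close> has cofinality \<open>cf(\<kappa>)\<close> in \<open>\<prec>\<close>; caught sets are only produced at such \<open>\<gamma>\<close>.\<close>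

definition ladder :: "'k set \<Rightarrow> 'k \<Rightarrow> 'k set" where
  "ladder \<gamma> = (SOME t. climbs t \<gamma>)"

text \<open>Built from the ladder fixed for the last index, hence a function of the node alone: all
  sets caught at one node are filtered by the same sequence, as \<open>disjoint_refinement\<close>
  demands.\<close>

definition E :: "'k set list \<Rightarrow> 'k \<Rightarrow> 'k set" where
  "E s a = (\<Union>b\<in>{b\<in>C. b \<sqsubseteq> a}. X (ladder (hd s) b # tl s))"

text \<open>The traces on \<open>S\<close> stay small but outgrow the levels of \<open>F\<close>
  cofinally often. This leaves room to avoid sets whose traces stay within the levels, as many of
  them at a time as a level has points.\<close>

definition stratified :: "('k \<Rightarrow> 'k set) \<Rightarrow> 'k set \<Rightarrow> bool" where
  "stratified S Z \<longleftrightarrow> \<not> small Z \<and> (\<forall>a\<in>C. small (Z \<inter> S a)) \<and>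
    (\<forall>j\<in>C. \<exists>a\<in>C. j \<sqsubseteq> a \<and> |F a| <o |Z \<inter> S a| )"

definition caught :: "'k set list \<Rightarrow> 'k set \<Rightarrow> bool" where
  "caught s Z \<longleftrightarrow> s \<noteq> [] \<and> orth s Z \<and> stratified (E s) Z"

lemma E_mono: "a \<sqsubseteq> b \<Longrightarrow> E s a \<subseteq> E s b"
  unfolding E_def using le_trans by blast

text \<open>A level \<open>a\<close> far enough out bounds the trace of \<open>Z\<close> on
  \<open>S j\<close> and the number of sets to be avoided, while the trace of \<open>Z\<close> on
  \<open>S a\<close> is larger than \<open>F a\<close>. Subtracting at most \<open>|F a|\<close>
  points from it leaves enough for \<open>W\<close>.\<close>

lemma stratified_step:
  assumes S_mono: "\<And>a b. a \<sqsubseteq> b \<Longrightarrow> S a \<subseteq> S b"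
    and Z: "stratified S Z"
    and I: "j \<in> C" "|I| \<le>o |F j|"
    and thin: "\<And>i a. i \<in> I \<Longrightarrow> a \<in> C \<Longrightarrow> |f i \<inter> S a| \<le>o |F a|"
  shows "\<exists>W \<subseteq> Z - S j - (\<Union>i\<in>I. f i). |W| =o |F j|"
proof -
  have "small (Z \<inter> S j)" using Z I(1) unfolding stratified_def by blast
  then obtain c where c: "c \<in> C" "|Z \<inter> S j| \<le>o |F c|" by (rule small_bound)
  obtain d where d: "d \<in> C" "j \<sqsubseteq> d" "c \<sqsubseteq> d"
    using le_total[OF I(1) c(1)] le_refl I(1) c(1) by blast
  obtain a where a: "a \<in> C" "d \<sqsubseteq> a" "|F a| <o |Z \<inter> S a|"
    using Z d(1) unfolding stratified_def by blast
  have ja: "j \<sqsubseteq> a" and ca: "c \<sqsubseteq> a" using d a(2) le_trans by blast+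
  have 1: "\<not> |Z \<inter> S a| \<le>o |F a|" by (rule not_ordLess_ordLeq[OF a(3)])
  have 2: "|Z \<inter> S j| \<le>o |F a|" by (rule ordLeq_transitive[OF c(2) F_le_mono[OF ca]])
  have "|I| \<le>o |F a|" by (rule ordLeq_transitive[OF I(2) F_le_mono[OF ja]])
  then have 3: "|\<Union>i\<in>I. f i \<inter> S a| \<le>o |F a|" by (rule UN_le_F[OF a(1)]) (rule thin[OF _ a(1)])
  have "\<not> |(Z \<inter> S a) - (Z \<inter> S j) - (\<Union>i\<in>I. f i \<inter> S a)| \<le>o |F a|"
    using card_of_diff_not_le[OF F_infinite[OF a(1)] card_of_diff_not_le[OF F_infinite[OF a(1)] 1 2] 3] .
  then have "\<not> |(Z \<inter> S a) - (Z \<inter> S j) - (\<Union>i\<in>I. f i \<inter> S a)| \<le>o |F j|"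
    using ordLeq_transitive[OF _ F_le_mono[OF ja]] by blast
  then obtain W where W: "W \<subseteq> (Z \<inter> S a) - (Z \<inter> S j) - (\<Union>i\<in>I. f i \<inter> S a)" "|W| =o |F j|"
    by (rule obtain_subset_of_card)
  then have "W \<subseteq> Z - S j - (\<Union>i\<in>I. f i)" by blast
  then show ?thesis using W(2) by blast
qed

text \<open>A recursion along \<open>\<prec>\<close> in which every value has traces within the
  levels of \<open>F\<close>. The earlier sets are coded by points of \<kappa>, and the piece
  \<open>W j\<close> avoids those with code in \<open>F j\<close>; so an earlier set is met only by
  boundedly many pieces.\<close>

lemma disjoint_refinement:
  fixes c :: "'k set \<Rightarrow> 'k set"
  assumes S_mono: "\<And>a b. a \<sqsubseteq> b \<Longrightarrow> S a \<subseteq> S b"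
    and c: "\<And>Y. Y \<in> J \<Longrightarrow> stratified S (c Y)"
  shows "\<exists>f. (\<forall>Y\<in>J. f Y \<subseteq> c Y \<and> \<not> small (f Y)) \<and>
    (\<forall>Y\<in>J. \<forall>Y'\<in>J. Y \<noteq> Y' \<longrightarrow> small (f Y \<inter> f Y'))"
proof -
  define P where "P f Y Z \<longleftrightarrow> (\<forall>a\<in>C. |Z \<inter> S a| \<le>o |F a| ) \<and>
    (Y \<in> J \<longrightarrow> Z \<subseteq> c Y \<and> \<not> small Z \<and> (\<forall>Y'. Y' \<prec> Y \<longrightarrow> small (Z \<inter> f Y')))"
    for f :: "'k set \<Rightarrow> 'k set" and Y Z
  have "\<exists>f. \<forall>Y. P f Y (f Y)"
  proof (rule dependent_wf_choice[OF lt_wf])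
    fix Y f assume IH: "\<And>Y'. (Y', Y) \<in> {(x, y). x \<prec> y} \<Longrightarrow> P f Y' (f Y')"
    show "\<exists>Z. P f Y Z"
    proof (cases "Y \<in> J")
      \<comment> \<open>Outside \<open>J\<close> the empty set serves as a default with trivial
        traces.\<close>
      case False
      then have "P f Y {}" unfolding P_def by (simp add: card_of_empty)
      then show ?thesis ..
    next
      case True
      obtain e :: "'k set \<Rightarrow> 'k" where e: "inj_on e {Y'. Y' \<prec> Y}"
        using lt_initial[of Y] card_of_ordLeq[of "{Y'. Y' \<prec> Y}" "UNIV :: 'k set"] by auto
      define I where "I j = {Y'. Y' \<prec> Y \<and> e Y' \<in> F j}" for j
      have I: "|I j| \<le>o |F j|" for j
      proof -
        have "inj_on e (I j)" using e by (rule inj_on_subset) (auto simp: I_def)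
        moreover have "e ` I j \<subseteq> F j" by (auto simp: I_def)
        ultimately show ?thesis using card_of_ordLeq[of "I j" "F j"] by blast
      qed
      have thin: "|f Y' \<inter> S a| \<le>o |F a|" if "Y' \<in> I j" "a \<in> C" for Y' a j
        using that IH unfolding P_def I_def by simp
      have "\<exists>W \<subseteq> c Y - S j - (\<Union>i\<in>I j. f i). |W| =o |F j|" if "j \<in> C" for j
        by (rule stratified_step[OF S_mono c[OF True] that I thin])
      then obtain W where W: "\<And>j. j \<in> C \<Longrightarrow> W j \<subseteq> c Y - S j - (\<Union>i\<in>I j. f i) \<and> |W j| =o |F j|"
        by metis
      have W_le: "|W j| \<le>o |F j|" "|F j| \<le>o |W j|" if "j \<in> C" for j
        using W[OF that] ordIso_iff_ordLeq by blast+
      define Z where "Z = (\<Union>j\<in>C. W j)"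
      have "|Z \<inter> S a| \<le>o |F a|" if a: "a \<in> C" for a
      proof (rule card_le_subset[OF _ UN_initial_le_F[OF a W_le(1)]])
        \<comment> \<open>The pieces \<open>W j\<close> avoid \<open>S j\<close>, so only those with
          \<open>j\<close> up to \<open>a\<close> can reach into \<open>S a\<close>.\<close>
        show "Z \<inter> S a \<subseteq> (\<Union>j\<in>{j\<in>C. j \<sqsubseteq> a}. W j)"
        proof
          fix y assume y: "y \<in> Z \<inter> S a"
          then obtain j where j: "j \<in> C" "y \<in> W j" unfolding Z_def by blast
          then have "y \<notin> S j" using W by blast
          then have "j \<sqsubseteq> a" using y le_total[OF a j(1)] S_mono by blast
          then show "y \<in> (\<Union>j\<in>{j\<in>C. j \<sqsubseteq> a}. W j)" using j by blast
        qed
      qed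
      moreover have "Z \<subseteq> c Y" unfolding Z_def using W by blast
      moreover have "\<not> small Z"
      proof (rule bigI)
        fix j assume "j \<in> C"
        then have "W j \<subseteq> Z" "|F j| \<le>o |W j|" using W_le unfolding Z_def by blast+
        then show "\<exists>W\<subseteq>Z. |F j| \<le>o |W|" by blast
      qed
      moreover have "small (Z \<inter> f Y')" if Y': "Y' \<prec> Y" for Y'
      proof -
        obtain a where a: "a \<in> C" "e Y' \<in> F a" by (rule exists_F)
        have "Z \<inter> f Y' \<subseteq> (\<Union>j\<in>{j\<in>C. j \<sqsubseteq> a}. W j)"
        proof
          fix y assume y: "y \<in> Z \<inter> f Y'"
          then obtain j where j: "j \<in> C" "y \<in> W j" unfolding Z_def by blast
          have "Y' \<notin> I j" using W[OF j(1)] j(2) y by blast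
          then have "e Y' \<notin> F j" using Y' unfolding I_def by blast
          then have "j \<sqsubseteq> a" using a le_total[OF a(1) j(1)] F_mono by blast
          then show "y \<in> (\<Union>j\<in>{j\<in>C. j \<sqsubseteq> a}. W j)" using j by blast
        qed
        then show ?thesis
          by (rule small_subset[OF small_if_le_F[OF a(1) UN_initial_le_F[OF a(1)]], rotated]) (rule W_le(1))
      qed
      ultimately have "P f Y Z" unfolding P_def by blast
      then show ?thesis ..
    qed
  qed (simp add: P_def)
  then obtain f where f: "\<And>Y. P f Y (f Y)" by blast
  have "f Y \<subseteq> c Y \<and> \<not> small (f Y)" if "Y \<in> J" for Y
    using f[of Y] that unfolding P_def by blast
  moreover have "small (f Y \<inter> f Y')" if J: "Y \<in> J" "Y' \<in> J" "Y \<noteq> Y'" for Y Y'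
  proof -
    have "small (f Y \<inter> f Y')" if "Y' \<prec> Y"
      using f[of Y] J that unfolding P_def by blast
    moreover have "small (f Y' \<inter> f Y)" if "Y \<prec> Y'"
      using f[of Y'] J that unfolding P_def by blast
    ultimately show ?thesis using J(3) lt_total[of Y Y'] by (auto simp: Int_commute)
  qed
  ultimately show ?thesis by blast
qed

section \<open>Every big set contains a caught set\<close>

text \<open>The members of the tower below \<open>s\<close> that \<open>Y\<close> meets in a way not
  already accounted for by earlier members.\<close>

definition reach :: "'k set list \<Rightarrow> 'k set \<Rightarrow> 'k set set" where
  "reach s Y = {\<gamma>. \<exists>Z\<subseteq>Y. \<not> small Z \<and> orth (\<gamma> # s) Z}"

lemma small_UN_initial:
  "a \<in> C \<Longrightarrow> (\<And>b. b \<in> C \<Longrightarrow> b \<sqsubseteq> a \<Longrightarrow> small (A b :: 'k set)) \<Longrightarrow> small (\<Union>b\<in>{b\<in>C. b \<sqsubseteq> a}. A b)"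
  by (rule small_UN[OF le_initial]) auto

lemma ladder_climbs: "climbs t \<gamma> \<Longrightarrow> climbs (ladder \<gamma>) \<gamma>"
  unfolding ladder_def by (rule someI[of "\<lambda>t. climbs t \<gamma>"])

lemma climbsD:
  assumes "climbs t \<gamma>"
  shows "a \<in> C \<Longrightarrow> t a \<prec> \<gamma>"
    and "a \<in> C \<Longrightarrow> b \<in> C \<Longrightarrow> a \<sqsubseteq> b \<Longrightarrow> t a = t b \<or> t a \<prec> t b"
    and "\<xi> \<prec> \<gamma> \<Longrightarrow> \<exists>a\<in>C. \<xi> = t a \<or> \<xi> \<prec> t a"
  using assms unfolding climbs_def by blast+

lemma C_le_UNIV: "|C| \<le>o |UNIV :: 'k set|"
  by (rule card_of_mono1) simp

lemma small_X_le: "\<xi> = \<gamma> \<or> \<xi> \<prec> \<gamma> \<Longrightarrow> small (X (\<xi> # s) - X (\<gamma> # s))"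
  using X_increasing[of \<xi> \<gamma> s] small_empty by (auto simp del: node.simps)

text \<open>A strictly increasing sequence \<open>g\<close> of length cf(\<kappa>) in
  \<open>reach s Y\<close> has a supremum \<open>\<gamma>\<close>. A transversal takes for each
  index a piece that is small, larger than a matching level of \<open>F\<close>, and disjoint from
  the earlier members along \<open>g\<close>; the union of the pieces meets every member before
  \<open>\<gamma>\<close> in a small set.\<close>

lemma caught_if_many_reached:
  assumes Y: "orth s Y" and many: "|C| \<le>o |reach s Y|"
  shows "\<exists>\<gamma> Z. Z \<subseteq> Y \<and> caught (\<gamma> # s) Z"
proof -
  obtain g where g: "\<And>c. c \<in> C \<Longrightarrow> g c \<in> reach s Y"
      "\<And>b c. b \<in> C \<Longrightarrow> c \<in> C \<Longrightarrow> b \<sqsubseteq> c \<Longrightarrow> b \<noteq> c \<Longrightarrow> g b \<prec> g c"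
    using lt_sequence[OF many] by blast
  have "|g ` C| \<le>o |UNIV :: 'k set|"
    by (rule ordLeq_transitive[OF card_of_image C_le_UNIV])
  from lt_bounded[OF this] obtain y where y: "\<forall>c\<in>C. g c \<prec> y" by blast
  obtain \<gamma> where bound: "\<forall>c\<in>C. g c \<prec> \<gamma>"
    and min: "\<And>\<xi>. \<xi> \<prec> \<gamma> \<Longrightarrow> \<not> (\<forall>c\<in>C. g c \<prec> \<xi>)"
    using lt_least[of "\<lambda>\<gamma>. \<forall>c\<in>C. g c \<prec> \<gamma>", OF y] by metis
  have \<gamma>: "g c \<prec> \<gamma>" if "c \<in> C" for c using bound that by blast
  have g_climbs: "climbs g \<gamma>"
    unfolding climbs_def
  proof (intro conjI allI ballI impI)
    fix \<xi> assume "\<xi> \<prec> \<gamma>"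
    then obtain c where "c \<in> C" "\<not> g c \<prec> \<xi>" using min by blast
    then show "\<exists>a\<in>C. \<xi> = g a \<or> \<xi> \<prec> g a" using lt_total[of \<xi> "g c"] by blast
  next
    fix a b assume "a \<in> C" "b \<in> C" "a \<sqsubseteq> b"
    then show "g a = g b \<or> g a \<prec> g b" using g(2) by blast
  qed (rule \<gamma>)
  define t where "t = ladder \<gamma>"
  have t: "climbs t \<gamma>" unfolding t_def by (rule ladder_climbs[OF g_climbs])
  \<comment> \<open>The ladder fixed for \<open>\<gamma>\<close> may differ from \<open>g\<close>.
    Each index \<open>c\<close> is therefore sent to a rung, not earlier than \<open>c\<close>, that
    lies at or above \<open>g c\<close>.\<close>
  have "\<exists>a\<in>C. c \<sqsubseteq> a \<and> (g c = t a \<or> g c \<prec> t a)" if c: "c \<in> C" for c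
  proof -
    obtain a where a: "a \<in> C" "g c = t a \<or> g c \<prec> t a" using climbsD(3)[OF t \<gamma>[OF c]] by blast
    show ?thesis
    proof (cases "c \<sqsubseteq> a")
      case False
      then have "a \<sqsubseteq> c" using le_total a(1) c by blast
      then have "t a = t c \<or> t a \<prec> t c" by (rule climbsD(2)[OF t a(1) c])
      then have "g c = t c \<or> g c \<prec> t c" using a(2) lt_trans by metis
      then show ?thesis using c le_refl by blast
    qed (use a in blast)
  qed
  then obtain a' where a': "\<And>c. c \<in> C \<Longrightarrow> a' c \<in> C \<and> c \<sqsubseteq> a' c \<and> (g c = t (a' c) \<or> g c \<prec> t (a' c))"
    by metis
  \<comment> \<open>Removing the earlier members gives the transversal. Staying in the member at
    rung \<open>a' c\<close> puts the piece into \<open>E (\<gamma> # s) (a' c)\<close>, and staying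
    in \<open>X (\<gamma> # s)\<close> serves \<open>orth\<close>.\<close>
  define V where "V c = X (t (a' c) # s) \<inter> X (\<gamma> # s) - (\<Union>b\<in>{b\<in>C. b \<sqsubseteq> c \<and> b \<noteq> c}. X (g b # s))" for c
  have "\<exists>W\<subseteq>Y \<inter> V c. small W \<and> |F (a' c)| <o |W|" if c: "c \<in> C" for c
  proof -
    obtain Z where Z: "Z \<subseteq> Y" "\<not> small Z" "orth (g c # s) Z"
      using g(1)[OF c] unfolding reach_def by blast
    have ZX: "Z \<subseteq> X (g c # s)" using orth_subset[OF Z(3)] .
    have 1: "small (X (g c # s) - X (t (a' c) # s))" by (rule small_X_le) (use a'[OF c] in blast)
    have 2: "small (X (g c # s) - X (\<gamma> # s))" by (rule X_increasing[OF \<gamma>[OF c]])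
    have "small (\<Union>b\<in>{b\<in>C. b \<sqsubseteq> c}. if b = c then {} else Z \<inter> X (g b # s))"
    proof (rule small_UN_initial[OF c])
      fix b assume b: "b \<in> C" "b \<sqsubseteq> c"
      show "small (if b = c then {} else Z \<inter> X (g b # s))"
        using Z(3) g(2)[OF b(1) c b(2)] small_empty by (simp del: node.simps)
    qed
    then have 3: "small (\<Union>b\<in>{b\<in>C. b \<sqsubseteq> c \<and> b \<noteq> c}. Z \<inter> X (g b # s))"
      by (rule small_subset) (auto simp del: node.simps)
    have "\<not> small (Z - (X (g c # s) - X (t (a' c) # s)) - (X (g c # s) - X (\<gamma> # s)) -
        (\<Union>b\<in>{b\<in>C. b \<sqsubseteq> c \<and> b \<noteq> c}. Z \<inter> X (g b # s)))"
      by (rule big_minus[OF big_minus[OF big_minus[OF Z(2) 1] 2] 3])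
    moreover have "Z - (X (g c # s) - X (t (a' c) # s)) - (X (g c # s) - X (\<gamma> # s)) -
        (\<Union>b\<in>{b\<in>C. b \<sqsubseteq> c \<and> b \<noteq> c}. Z \<inter> X (g b # s)) \<subseteq> Y \<inter> V c"
      unfolding V_def using ZX Z(1) by blast
    ultimately have big: "\<not> small (Y \<inter> V c)" using small_subset by blast
    \<comment> \<open>A piece of the size of \<open>F j\<close> is small, yet larger than level
      \<open>a' c\<close>, as stratification requires.\<close>
    obtain j where j: "j \<in> C" "|F (a' c)| <o |F j|" using F_unbounded[of "a' c"] a'[OF c] by blast
    obtain W where W: "W \<subseteq> Y \<inter> V c" "|W| =o |F j|"
      by (rule obtain_subset_of_card[OF big_not_le_F[OF big j(1)]])
    have "small W" by (rule small_if_le_F[OF j(1) ordIso_imp_ordLeq[OF W(2)]])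
    moreover have "|F (a' c)| <o |W|" by (rule ordLess_ordIso_trans[OF j(2) ordIso_symmetric[OF W(2)]])
    ultimately show ?thesis using W(1) by blast
  qed
  then obtain W where W: "\<And>c. c \<in> C \<Longrightarrow> W c \<subseteq> Y \<inter> V c \<and> small (W c) \<and> |F (a' c)| <o |W c|"
    by metis
  define Z where "Z = (\<Union>c\<in>C. W c)"
  have ZY: "Z \<subseteq> Y" unfolding Z_def using W by blast
  have "Z \<subseteq> X (\<gamma> # s)" unfolding Z_def using W unfolding V_def by blast
  moreover have below_g: "small (Z \<inter> X (g b # s))" if b: "b \<in> C" for b
  proof -
    have "small (\<Union>c\<in>{c\<in>C. c \<sqsubseteq> b}. W c)" by (rule small_UN_initial[OF b]) (use W in blast)
    moreover have "Z \<inter> X (g b # s) \<subseteq> (\<Union>c\<in>{c\<in>C. c \<sqsubseteq> b}. W c)"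
    proof
      fix y assume y: "y \<in> Z \<inter> X (g b # s)"
      then obtain c where c: "c \<in> C" "y \<in> W c" unfolding Z_def by blast
      then have "y \<in> V c" using W by blast
      then have "\<not> (b \<sqsubseteq> c \<and> b \<noteq> c)" using y b unfolding V_def by blast
      then have "c \<sqsubseteq> b" using le_total[OF b c(1)] le_refl b by blast
      then show "y \<in> (\<Union>c\<in>{c\<in>C. c \<sqsubseteq> b}. W c)" using c by blast
    qed
    ultimately show ?thesis by (rule small_subset)
  qed
  have below: "small (Z \<inter> X (\<xi> # s))" if \<xi>: "\<xi> \<prec> \<gamma>" for \<xi>
  proof -
    obtain b where b: "b \<in> C" "\<xi> = g b \<or> \<xi> \<prec> g b" using climbsD(3)[OF g_climbs \<xi>] by blast
    have "small ((X (\<xi> # s) - X (g b # s)) \<union> (Z \<inter> X (g b # s)))"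
      by (rule small_Un[OF small_X_le[OF b(2)] below_g[OF b(1)]])
    then show ?thesis by (rule small_subset) blast
  qed
  have "orth (\<gamma> # s) Z" using below orth_mono[OF Y ZY] \<open>Z \<subseteq> X (\<gamma> # s)\<close> by (simp del: node.simps)
  moreover have "stratified (E (\<gamma> # s)) Z"
    unfolding stratified_def
  proof (intro conjI ballI)
    show "\<not> small Z"
    proof (rule bigI)
      fix c assume c: "c \<in> C"
      have "|F c| \<le>o |F (a' c)|" by (rule F_le_mono) (use a'[OF c] in blast)
      moreover have "|F (a' c)| \<le>o |W c|" by (rule ordLess_imp_ordLeq) (use W[OF c] in blast)
      ultimately have "|F c| \<le>o |W c|" by (rule ordLeq_transitive)
      moreover have "W c \<subseteq> Z" unfolding Z_def using c by blast
      ultimately show "\<exists>W\<subseteq>Z. |F c| \<le>o |W|" by blast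
    qed
    fix a assume a: "a \<in> C"
    have "small (\<Union>b\<in>{b\<in>C. b \<sqsubseteq> a}. Z \<inter> X (t b # s))"
      by (rule small_UN_initial[OF a]) (rule below[OF climbsD(1)[OF t]])
    then show "small (Z \<inter> E (\<gamma> # s) a)"
      by (rule small_subset) (auto simp: E_def t_def simp del: node.simps)
    have "W a \<subseteq> Z \<inter> E (\<gamma> # s) (a' a)"
    proof -
      have "W a \<subseteq> Z" unfolding Z_def using a by blast
      moreover have "W a \<subseteq> X (t (a' a) # s)" using W[OF a] unfolding V_def by blast
      moreover have "X (t (a' a) # s) \<subseteq> E (\<gamma> # s) (a' a)"
        unfolding E_def t_def using a'[OF a] le_refl by (auto simp del: node.simps)
      ultimately show ?thesis by blast
    qed
    from ordLess_ordLeq_trans[OF _ card_of_mono1[OF this]]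
    have "|F (a' a)| <o |Z \<inter> E (\<gamma> # s) (a' a)|" using W[OF a] by blast
    then show "\<exists>b\<in>C. a \<sqsubseteq> b \<and> |F b| <o |Z \<inter> E (\<gamma> # s) b|" using a'[OF a] by blast
  qed
  ultimately have "caught (\<gamma> # s) Z" unfolding caught_def by simp
  then show ?thesis using ZY by blast
qed

section \<open>Splitting a big set along the tree\<close>

lemma least_hit:
  assumes "orth s A" "\<not> small (A \<inter> X (\<gamma> # s))"
  obtains \<xi> where "\<xi> = \<gamma> \<or> \<xi> \<prec> \<gamma>" "\<not> small (A \<inter> X (\<xi> # s))" "orth (\<xi> # s) (A \<inter> X (\<xi> # s))"
proof -
  obtain \<xi> where \<xi>: "(\<xi> = \<gamma> \<or> \<xi> \<prec> \<gamma>) \<and> \<not> small (A \<inter> X (\<xi> # s))"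
    and min: "\<And>\<eta>. \<eta> \<prec> \<xi> \<Longrightarrow> \<not> ((\<eta> = \<gamma> \<or> \<eta> \<prec> \<gamma>) \<and> \<not> small (A \<inter> X (\<eta> # s)))"
    using lt_least[of "\<lambda>\<xi>. (\<xi> = \<gamma> \<or> \<xi> \<prec> \<gamma>) \<and> \<not> small (A \<inter> X (\<xi> # s))" \<gamma>] assms(2) by metis
  have "small (A \<inter> X (\<xi> # s) \<inter> X (\<eta> # s))" if "\<eta> \<prec> \<xi>" for \<eta>
  proof -
    have "\<eta> \<prec> \<gamma>" using \<xi> that lt_trans by blast
    then have "small (A \<inter> X (\<eta> # s))" using min[OF that] by blast
    then show ?thesis by (rule small_subset) blast
  qed
  then have "orth (\<xi> # s) (A \<inter> X (\<xi> # s))"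
    using orth_mono[OF assms(1)] by (simp del: node.simps)
  then show ?thesis using that \<xi> by blast
qed

text \<open>A pointwise sorting: among the reached indices, each point follows the first whose
  member contains it, so it enters at most one child of a node.\<close>

primrec branch :: "'k set \<Rightarrow> 'k set list \<Rightarrow> 'k set" where
  "branch Y [] = Y"
| "branch Y (\<gamma> # s) = {y \<in> branch Y s. \<gamma> \<in> reach s (branch Y s) \<and> y \<in> X (\<gamma> # s) \<and>
    (\<forall>\<xi>. \<xi> \<in> reach s (branch Y s) \<longrightarrow> \<xi> \<prec> \<gamma> \<longrightarrow> y \<notin> X (\<xi> # s))}"

lemma branch_subset: "branch Y s \<subseteq> Y"
  by (induction s) auto

text \<open>Only reached members are removed by definition, but an earlier unreached one cannot meet
  the branch in a big set either: the least index doing so would be reached.\<close>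

lemma orth_branch: "orth s (branch Y s)"
proof (induction s)
  case (Cons \<gamma> s)
  let ?B = "branch Y (\<gamma> # s)"
  have sub: "?B \<subseteq> branch Y s" by auto
  have B: "orth s ?B" by (rule orth_mono[OF Cons sub])
  have "small (?B \<inter> X (\<xi> # s))" if "\<xi> \<prec> \<gamma>" for \<xi>
  proof (rule ccontr)
    assume "\<not> small (?B \<inter> X (\<xi> # s))"
    then obtain \<eta> where \<eta>: "\<eta> = \<xi> \<or> \<eta> \<prec> \<xi>" "\<not> small (?B \<inter> X (\<eta> # s))"
        "orth (\<eta> # s) (?B \<inter> X (\<eta> # s))"
      by (rule least_hit[OF B])
    have "\<eta> \<prec> \<gamma>" using \<eta>(1) that lt_trans by blast
    moreover have "\<eta> \<in> reach s (branch Y s)" unfolding reach_def using \<eta>(2,3) sub by blast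
    ultimately have "?B \<inter> X (\<eta> # s) = {}" by (auto simp del: node.simps)
    then show False using \<eta>(2) small_empty by simp
  qed
  then show ?case using B by (auto simp del: node.simps)
qed simp

definition dropped :: "'k set \<Rightarrow> 'k set list \<Rightarrow> 'k set" where
  "dropped Y s = branch Y s - (\<Union>\<gamma>\<in>reach s (branch Y s). X (\<gamma> # s))"

lemma small_dropped: "small (dropped Y s)"
proof (rule ccontr)
  let ?A = "dropped Y s"
  assume "\<not> small ?A"
  have sub: "?A \<subseteq> branch Y s" unfolding dropped_def by blast
  then have A: "orth s ?A" using orth_mono orth_branch by blast
  \<comment> \<open>If big, the set \<open>?A\<close> is hit by the tower at the stage indexed by
    \<open>?A\<close> itself.\<close>
  have "\<not> small (?A \<inter> X (?A # s))" by (rule X_hits[OF orth_subset[OF A]]) fact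
  then obtain \<xi> where \<xi>: "\<not> small (?A \<inter> X (\<xi> # s))" "orth (\<xi> # s) (?A \<inter> X (\<xi> # s))"
    using least_hit[OF A] by metis
  then have "\<xi> \<in> reach s (branch Y s)" unfolding reach_def using sub by blast
  then have "?A \<inter> X (\<xi> # s) = {}" unfolding dropped_def by blast
  then show False using \<xi>(1) small_empty by simp
qed

lemma branch_step:
  assumes "y \<in> branch Y s" "y \<notin> dropped Y s"
  obtains \<gamma> where "\<gamma> \<in> reach s (branch Y s)" "y \<in> branch Y (\<gamma> # s)"
proof -
  let ?Q = "\<lambda>\<gamma>. \<gamma> \<in> reach s (branch Y s) \<and> y \<in> X (\<gamma> # s)"
  obtain \<gamma>0 where "?Q \<gamma>0" using assms unfolding dropped_def by blast
  then obtain \<gamma> where "?Q \<gamma>" "\<And>\<eta>. \<eta> \<prec> \<gamma> \<Longrightarrow> \<not> ?Q \<eta>"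
    using lt_least[of ?Q \<gamma>0] by metis
  then show ?thesis using that[of \<gamma>] assms(1) by (auto simp del: node.simps)
qed

text \<open>The points that leave the tree exactly \<open>n\<close> levels below
  \<open>s\<close>.\<close>

primrec dropped_by :: "'k set \<Rightarrow> nat \<Rightarrow> 'k set list \<Rightarrow> 'k set" where
  "dropped_by Y 0 s = dropped Y s"
| "dropped_by Y (Suc n) s = (\<Union>\<gamma>\<in>reach s (branch Y s). dropped_by Y n (\<gamma> # s))"

lemma small_dropped_by:
  assumes "\<And>s. |reach s (branch Y s)| <o |C|"
  shows "small (dropped_by Y n s)"
proof (induction n arbitrary: s)
  case 0
  then show ?case by (simp add: small_dropped)
next
  case (Suc n)
  show ?case unfolding dropped_by.simps by (rule small_UN[OF assms]) (rule Suc)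
qed

text \<open>A point never dropped would continue from each of its nodes to a longer one with
  strictly smaller rank; a node of least rank for that point rules this out.\<close>

lemma subset_dropped_by: "Y \<subseteq> (\<Union>n. dropped_by Y n [])"
proof (rule ccontr)
  assume "\<not> ?thesis"
  then obtain y where y: "y \<in> Y" "\<And>n. y \<notin> dropped_by Y n []" by blast
  let ?Q = "{s. y \<in> branch Y s \<and> (\<forall>n. y \<notin> dropped_by Y n s)}"
  have "[] \<in> ?Q" using y by simp
  moreover have inX: "y \<in> X s" if "s \<in> ?Q" for s
    using that orth_subset[OF orth_branch] by blast
  then have "(\<lambda>s. rank s y) ` ?Q \<subseteq> C" using ranked_in[OF ranked_node] by blast
  ultimately obtain s where s: "s \<in> ?Q" and min: "\<And>u. u \<in> ?Q \<Longrightarrow> rank s y \<sqsubseteq> rank u y"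
    using le_wellorder[of "(\<lambda>s. rank s y) ` ?Q"] by blast
  have "y \<notin> dropped_by Y 0 s" using s by blast
  then obtain \<gamma> where \<gamma>: "\<gamma> \<in> reach s (branch Y s)" "y \<in> branch Y (\<gamma> # s)"
    using s branch_step[of y Y s] by auto
  have "y \<notin> dropped_by Y n (\<gamma> # s)" for n
  proof -
    have "y \<notin> dropped_by Y (Suc n) s" using s by blast
    then show ?thesis using \<gamma>(1) by auto
  qed
  then have Q: "\<gamma> # s \<in> ?Q" using \<gamma>(2) by blast
  show False using min[OF Q] rank_Cons[OF inX[OF Q]] le_antisym by blast
qed

text \<open>Without a caught set, every node would reach fewer than cf(\<kappa>) members, so
  \<open>Y\<close> would be covered by small sets, one for each level. Uncountable cofinality makes
  this countable union small.\<close>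

lemma exists_caught:
  assumes "\<not> small Y"
  obtains s Z where "Z \<subseteq> Y" "caught s Z"
proof (rule ccontr)
  assume none: "\<not> thesis"
  have "|reach s (branch Y s)| <o |C|" for s
  proof (rule ccontr)
    assume "\<not> ?thesis"
    then have "|C| \<le>o |reach s (branch Y s)|" using card_not_le_iff by blast
    from caught_if_many_reached[OF orth_branch this] show False
      using none that branch_subset[of Y s] by blast
  qed
  then have "small (\<Union>n. dropped_by Y n [])"
    by (intro countable_small_UN small_dropped_by)
  then have "small Y" by (rule small_subset[OF _ subset_dropped_by])
  then show False using assms by blast
qed

text \<open>The colour \<open>k Y\<close> is the length of the node at which a subset of
  \<open>Y\<close> is caught. For equal nodes \<open>disjoint_refinement\<close> separates the sets;
  for distinct nodes of equal length orthogonality does.\<close>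

lemma sigma_disjoint_refinement:
  obtains Z :: "'k set \<Rightarrow> 'k set" and k :: "'k set \<Rightarrow> nat" where
    "\<And>Y. \<not> small Y \<Longrightarrow> Z Y \<subseteq> Y \<and> \<not> small (Z Y)"
    "\<And>Y Y'. \<not> small Y \<Longrightarrow> \<not> small Y' \<Longrightarrow> Y \<noteq> Y' \<Longrightarrow> k Y = k Y' \<Longrightarrow> small (Z Y \<inter> Z Y')"
proof -
  have "\<exists>s Z. Z \<subseteq> Y \<and> caught s Z" if "\<not> small Y" for Y
    using exists_caught[OF that] by metis
  then obtain s c where sc: "\<And>Y. \<not> small Y \<Longrightarrow> c Y \<subseteq> Y \<and> caught (s Y) (c Y)" by metis
  define J where "J u = {Y. \<not> small Y \<and> s Y = u}" for u
  have "\<exists>f. (\<forall>Y\<in>J u. f Y \<subseteq> c Y \<and> \<not> small (f Y)) \<and>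
      (\<forall>Y\<in>J u. \<forall>Y'\<in>J u. Y \<noteq> Y' \<longrightarrow> small (f Y \<inter> f Y'))" for u
  proof (rule disjoint_refinement)
    show "E u a \<subseteq> E u b" if "a \<sqsubseteq> b" for a b using that by (rule E_mono)
    show "stratified (E u) (c Y)" if "Y \<in> J u" for Y
      using that sc[of Y] unfolding J_def caught_def by auto
  qed
  then obtain f where f: "\<And>u Y. Y \<in> J u \<Longrightarrow> f u Y \<subseteq> c Y \<and> \<not> small (f u Y)"
      "\<And>u Y Y'. Y \<in> J u \<Longrightarrow> Y' \<in> J u \<Longrightarrow> Y \<noteq> Y' \<Longrightarrow> small (f u Y \<inter> f u Y')"
    by metis
  define Z where "Z Y = f (s Y) Y" for Y
  have Z: "Z Y \<subseteq> c Y \<and> \<not> small (Z Y)" if "\<not> small Y" for Y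
    using f(1)[of Y "s Y"] that unfolding J_def Z_def by blast
  have "small (Z Y \<inter> Z Y')"
    if Y: "\<not> small Y" "\<not> small Y'" "Y \<noteq> Y'" "length (s Y) = length (s Y')" for Y Y'
  proof (cases "s Y = s Y'")
    case True
    then have "Y \<in> J (s Y')" "Y' \<in> J (s Y')" using Y unfolding J_def by auto
    then show ?thesis using f(2) Y(3) True unfolding Z_def by simp
  next
    case False
    have "orth (s A) (Z A)" if "\<not> small A" for A
    proof (rule orth_mono)
      show "orth (s A) (c A)" using sc[OF that] unfolding caught_def by blast
      show "Z A \<subseteq> c A" using Z[OF that] by blast
    qed
    from this[OF Y(1)] this[OF Y(2)]
    show ?thesis by (rule orth_almost_disjoint[OF Y(4) False])
  qed
  moreover have "Z Y \<subseteq> Y \<and> \<not> small (Z Y)" if "\<not> small Y" for Y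
    using Z[OF that] sc[OF that] by blast
  ultimately show ?thesis using that[of Z "\<lambda>Y. length (s Y)"] by blast
qed

text \<open>The constant family whose value is one caught set, indexed by all of
  \<open>'k set\<close>, is refined to 2^\<kappa> almost disjoint subsets.\<close>

lemma large_almost_disjoint_family:
  assumes "\<not> small Y"
  obtains f :: "'k set \<Rightarrow> 'k set" where "\<And>\<gamma>. f \<gamma> \<subseteq> Y \<and> \<not> small (f \<gamma>)"
    "\<And>\<gamma> \<delta>. \<gamma> \<noteq> \<delta> \<Longrightarrow> small (f \<gamma> \<inter> f \<delta>)"
proof -
  obtain s Z where Z: "Z \<subseteq> Y" "caught s Z" by (rule exists_caught[OF assms])
  then have "stratified (E s) Z" unfolding caught_def by blast
  have "\<exists>f :: 'k set \<Rightarrow> 'k set. (\<forall>\<gamma>\<in>UNIV. f \<gamma> \<subseteq> Z \<and> \<not> small (f \<gamma>)) \<and>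
      (\<forall>\<gamma>\<in>UNIV. \<forall>\<delta>\<in>UNIV. \<gamma> \<noteq> \<delta> \<longrightarrow> small (f \<gamma> \<inter> f \<delta>))"
  proof (rule disjoint_refinement)
    show "E s a \<subseteq> E s b" if "a \<sqsubseteq> b" for a b using that by (rule E_mono)
    show "stratified (E s) Z" by fact
  qed
  then obtain f :: "'k set \<Rightarrow> 'k set" where "\<And>\<gamma>. f \<gamma> \<subseteq> Z \<and> \<not> small (f \<gamma>)"
      "\<And>\<gamma> \<delta>. \<gamma> \<noteq> \<delta> \<Longrightarrow> small (f \<gamma> \<inter> f \<delta>)"
    by auto
  then show ?thesis using that[of f] Z(1) by blast
qed

end

section \<open>A dense tree of big sets\<close>

lemma col_incomparable:
  assumes "\<not> col_le s t" "\<not> col_le t s"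
  obtains p a b s' t' where "s = p @ a # s'" "t = p @ b # t'" "a \<noteq> b"
proof -
  have "\<exists>p a b s' t'. s = p @ a # s' \<and> t = p @ b # t' \<and> a \<noteq> b"
    using assms
  proof (induction s arbitrary: t)
    case Nil
    then show ?case by (simp add: col_le_def)
  next
    case (Cons x s)
    then obtain y u where t: "t = y # u" by (cases t) (auto simp: col_le_def)
    show ?case
    proof (cases "x = y")
      case True
      then have "\<not> col_le s u" "\<not> col_le u s" using Cons.prems t by (auto simp: col_le_def)
      then obtain p a b s' t' where "s = p @ a # s'" "u = p @ b # t'" "a \<noteq> b"
        using Cons.IH by blast
      then have "x # s = (x # p) @ a # s'" "t = (x # p) @ b # t'" using t True by simp_all
      then show ?thesis using \<open>a \<noteq> b\<close> by blast
    next
      case False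
      then have "x # s = [] @ x # s" "t = [] @ y # u" using t by simp_all
      then show ?thesis using False by blast
    qed
  qed
  then show ?thesis using that by blast
qed

context singular_filtration begin

text \<open>Zorn's lemma is started from an almost disjoint family of size 2^\<kappa>, shrunk into
  \<open>D\<close>; so the maximal family has exactly that size and can be indexed by
  \<open>'k set\<close>.\<close>

lemma maximal_almost_disjoint:
  assumes dense: "\<And>Y. Y \<subseteq> A \<Longrightarrow> \<not> small Y \<Longrightarrow> \<exists>B\<subseteq>Y. B \<in> D" and big: "\<And>B. B \<in> D \<Longrightarrow> \<not> small B"
    and "\<not> small A"
  shows "\<exists>f :: 'k set \<Rightarrow> 'k set. (\<forall>\<gamma>. f \<gamma> \<in> D \<and> f \<gamma> \<subseteq> A) \<and>
    (\<forall>\<gamma> \<delta>. \<gamma> \<noteq> \<delta> \<longrightarrow> small (f \<gamma> \<inter> f \<delta>)) \<and>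
    (\<forall>Y. Y \<subseteq> A \<longrightarrow> \<not> small Y \<longrightarrow> (\<exists>\<gamma>. \<not> small (Y \<inter> f \<gamma>)))"
proof -
  obtain g :: "'k set \<Rightarrow> 'k set" where g: "\<And>\<gamma>. g \<gamma> \<subseteq> A \<and> \<not> small (g \<gamma>)"
      "\<And>\<gamma> \<delta>. \<gamma> \<noteq> \<delta> \<Longrightarrow> small (g \<gamma> \<inter> g \<delta>)"
    using large_almost_disjoint_family[OF assms(3)] by metis
  have "\<exists>B\<subseteq>g \<gamma>. B \<in> D" for \<gamma>
    using dense[of "g \<gamma>"] g(1)[of \<gamma>] by blast
  then obtain h where h: "\<And>\<gamma>. h \<gamma> \<subseteq> g \<gamma> \<and> h \<gamma> \<in> D" by metis
  have h_disj: "small (h \<gamma> \<inter> h \<delta>)" if "\<gamma> \<noteq> \<delta>" for \<gamma> \<delta>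
    by (rule small_subset[OF g(2)[OF that]]) (use h in blast)
  have h_inj: "inj h"
  proof (rule injI, rule ccontr)
    fix \<gamma> \<delta> assume "h \<gamma> = h \<delta>" "\<gamma> \<noteq> \<delta>"
    then have "small (h \<gamma>)" using h_disj[of \<gamma> \<delta>] by simp
    then show False using big h by blast
  qed
  define \<F> where "\<F> = {M. range h \<subseteq> M \<and> M \<subseteq> D \<inter> Pow A \<and> (\<forall>B\<in>M. \<forall>B'\<in>M. B \<noteq> B' \<longrightarrow> small (B \<inter> B'))}"
  have "\<exists>M\<in>\<F>. \<forall>N\<in>\<F>. M \<subseteq> N \<longrightarrow> N = M"
  proof (rule subset_Zorn_nonempty)
    have "h \<gamma> \<in> D \<inter> Pow A" for \<gamma> using h[of \<gamma>] g(1)[of \<gamma>] by blast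
    moreover have "small (h \<gamma> \<inter> h \<delta>)" if "h \<gamma> \<noteq> h \<delta>" for \<gamma> \<delta> using h_disj[of \<gamma> \<delta>] that by metis
    ultimately have "range h \<in> \<F>" unfolding \<F>_def by auto
    then show "\<F> \<noteq> {}" by blast
    fix \<C> assume "\<C> \<noteq> {}" and chain: "subset.chain \<F> \<C>"
    have sub: "\<C> \<subseteq> \<F>" and cmp: "\<And>M N. M \<in> \<C> \<Longrightarrow> N \<in> \<C> \<Longrightarrow> M \<subseteq> N \<or> N \<subseteq> M"
      using chain by (auto simp: subset_chain_def)
    have "small (B \<inter> B')" if B: "B \<in> \<Union>\<C>" "B' \<in> \<Union>\<C>" "B \<noteq> B'" for B B'
    proof -
      obtain M where "M \<in> \<C>" "B \<in> M" "B' \<in> M" using B(1,2) cmp by blast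
      then show ?thesis using sub B(3) unfolding \<F>_def by blast
    qed
    moreover have "range h \<subseteq> \<Union>\<C>" using \<open>\<C> \<noteq> {}\<close> sub unfolding \<F>_def by blast
    moreover have "\<Union>\<C> \<subseteq> D \<inter> Pow A" using sub unfolding \<F>_def by blast
    ultimately show "\<Union>\<C> \<in> \<F>" unfolding \<F>_def by blast
  qed
  then obtain M where M: "M \<in> \<F>" and max: "\<And>N. N \<in> \<F> \<Longrightarrow> M \<subseteq> N \<Longrightarrow> N = M" by blast
  have M_range: "range h \<subseteq> M" and M_D: "M \<subseteq> D \<inter> Pow A"
    and M_disj: "\<forall>B\<in>M. \<forall>B'\<in>M. B \<noteq> B' \<longrightarrow> small (B \<inter> B')"
    using M unfolding \<F>_def by simp_all
  have "|UNIV :: 'k set set| =o |range h|"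
    using card_of_ordIsoI[OF inj_on_imp_bij_betw[OF h_inj]] .
  moreover have "|range h| \<le>o |M|" by (rule card_of_mono1[OF M_range])
  moreover have "|M| \<le>o |UNIV :: 'k set set|" by (rule card_of_mono1) simp
  ultimately have "|UNIV :: 'k set set| =o |M|"
    using ordIso_iff_ordLeq ordIso_ordLeq_trans by metis
  then obtain f where f: "bij_betw f (UNIV :: 'k set set) M" using card_of_ordIso by blast
  have fM: "f \<gamma> \<in> M" for \<gamma> using f by (auto simp: bij_betw_def)
  show ?thesis
  proof (intro exI[of _ f] conjI allI impI)
    show "f \<gamma> \<in> D" "f \<gamma> \<subseteq> A" for \<gamma> using fM[of \<gamma>] M_D by blast+
    show "small (f \<gamma> \<inter> f \<delta>)" if "\<gamma> \<noteq> \<delta>" for \<gamma> \<delta>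
    proof -
      have "f \<gamma> \<noteq> f \<delta>" using f that by (auto simp: bij_betw_def inj_on_def)
      then show ?thesis using fM M_disj by simp
    qed
    show "\<exists>\<gamma>. \<not> small (Y \<inter> f \<gamma>)" if Y: "Y \<subseteq> A" "\<not> small Y" for Y
    proof (rule ccontr)
      assume *: "\<nexists>\<gamma>. \<not> small (Y \<inter> f \<gamma>)"
      have YM: "small (Y \<inter> B)" if "B \<in> M" for B
        using * that f by (auto simp: bij_betw_def)
      \<comment> \<open>A big set almost disjoint from the whole family contains a member of
        \<open>D\<close> that could be added to it.\<close>
      obtain B where B: "B \<subseteq> Y" "B \<in> D" using dense[OF Y] by blast
      have BM: "small (B \<inter> B')" if "B' \<in> M" for B'
        by (rule small_subset[OF YM[OF that]]) (use B(1) in blast)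
      have "small (B1 \<inter> B2)" if "B1 \<in> insert B M" "B2 \<in> insert B M" "B1 \<noteq> B2" for B1 B2
        using that M_disj BM[of B1] BM[of B2] by (auto simp: Int_commute)
      moreover have "B \<in> D \<inter> Pow A" using B Y(1) by blast
      ultimately have "insert B M \<in> \<F>" using M_D M_range unfolding \<F>_def by (simp add: subset_insertI2)
      then have "B \<in> M" using max by blast
      then show False using BM big[OF B(2)] by fastforce
    qed
  qed
qed

text \<open>Step \<open>n\<close> of the tree decides the pieces of colour \<open>n\<close>. Given
  \<open>Y\<close>, some node just after step \<open>k Y\<close> meets \<open>Z Y\<close> in a big
  set; it lies inside a single piece of that colour, which can only be \<open>Z Y\<close>, and hence
  inside \<open>Y\<close>.\<close>

lemma dense_tree:
  obtains e :: "'k set list \<Rightarrow> 'k set" where "\<And>s. \<not> small (e s)"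
    "\<And>s t. col_le s t \<Longrightarrow> e s \<subseteq> e t"
    "\<And>s t. \<not> col_le s t \<Longrightarrow> \<not> col_le t s \<Longrightarrow> small (e s \<inter> e t)"
    "\<And>Y. \<not> small Y \<Longrightarrow> \<exists>s. e s \<subseteq> Y"
proof -
  obtain Z :: "'k set \<Rightarrow> 'k set" and k :: "'k set \<Rightarrow> nat" where
    Z: "\<And>Y. \<not> small Y \<Longrightarrow> Z Y \<subseteq> Y \<and> \<not> small (Z Y)" and
    Z_disj: "\<And>Y Y'. \<not> small Y \<Longrightarrow> \<not> small Y' \<Longrightarrow> Y \<noteq> Y' \<Longrightarrow> k Y = k Y' \<Longrightarrow> small (Z Y \<inter> Z Y')"
    using sigma_disjoint_refinement by metis
  \<comment> \<open>The big sets that have decided colour \<open>n\<close>; they are dense for each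
    \<open>n\<close>.\<close>
  define D where "D n = {B. \<not> small B \<and> ((\<exists>Y. \<not> small Y \<and> k Y = n \<and> B \<subseteq> Z Y) \<or>
      (\<forall>Y. \<not> small Y \<longrightarrow> k Y = n \<longrightarrow> small (B \<inter> Z Y)))}" for n
  have D_dense: "\<exists>B\<subseteq>Y. B \<in> D n" if "\<not> small Y" for Y n
  proof (cases "\<exists>Y'. \<not> small Y' \<and> k Y' = n \<and> \<not> small (Y \<inter> Z Y')")
    case True
    then obtain Y' where "\<not> small Y'" "k Y' = n" "\<not> small (Y \<inter> Z Y')" by blast
    then have "Y \<inter> Z Y' \<in> D n" unfolding D_def by blast
    then show ?thesis by blast
  next
    case False
    then have "Y \<in> D n" using that unfolding D_def by blast
    then show ?thesis by blast
  qed
  have D_big: "\<not> small B" if "B \<in> D n" for B n using that unfolding D_def by blast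
  define Q where "Q n A f \<longleftrightarrow> (\<forall>\<gamma>. f \<gamma> \<in> D n \<and> f \<gamma> \<subseteq> A) \<and>
      (\<forall>\<gamma> \<delta>. \<gamma> \<noteq> \<delta> \<longrightarrow> small (f \<gamma> \<inter> f \<delta>)) \<and>
      (\<forall>Y. Y \<subseteq> A \<longrightarrow> \<not> small Y \<longrightarrow> (\<exists>\<gamma>. \<not> small (Y \<inter> f \<gamma>)))"
    for n A and f :: "'k set \<Rightarrow> 'k set"
  have Q_ex: "\<exists>f. Q n A f" if A: "\<not> small A" for n A
    unfolding Q_def by (rule maximal_almost_disjoint[of A "D n", OF D_dense D_big A])
  define f where "f n A = (SOME g. Q n A g)" for n A
  have Q: "Q n A (f n A)" if "\<not> small A" for n A
    unfolding f_def by (rule someI_ex[OF Q_ex[OF that]])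
  have f: "f n A \<gamma> \<in> D n \<and> f n A \<gamma> \<subseteq> A" if "\<not> small A" for n A \<gamma>
    using Q[OF that, of n] unfolding Q_def by blast
  have f_disj: "small (f n A \<gamma> \<inter> f n A \<delta>)" if "\<not> small A" "\<gamma> \<noteq> \<delta>" for n A \<gamma> \<delta>
    using Q[OF that(1), of n] that(2) unfolding Q_def by blast
  have f_max: "\<exists>\<gamma>. \<not> small (Y \<inter> f n A \<gamma>)" if "\<not> small A" "Y \<subseteq> A" "\<not> small Y" for n A Y
    using Q[OF that(1), of n] that(2,3) unfolding Q_def by blast
  \<comment> \<open>The newest entry is at the head and \<open>length s\<close> counts the earlier
    ones, so a node of length \<open>Suc n\<close> lies in \<open>D n\<close>.\<close>
  define N where "N = rec_list (UNIV :: 'k set) (\<lambda>\<gamma> s A. f (length s) A \<gamma>)"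
  have N_Nil: "N [] = UNIV" and N_Cons: "N (\<gamma> # s) = f (length s) (N s) \<gamma>" for \<gamma> s
    unfolding N_def by simp_all
  have N_big: "\<not> small (N s)" for s
  proof (induction s)
    case Nil
    have "\<not> |UNIV :: 'k set| <o |UNIV :: 'k set|" using card_not_le_iff card_of_mono1 by blast
    then show ?case unfolding N_Nil small_def .
  next
    case (Cons \<gamma> s)
    have "N (\<gamma> # s) \<in> D (length s)" unfolding N_Cons using f[OF Cons] by blast
    then show ?case unfolding D_def by blast
  qed
  have N_append: "N (u @ s) \<subseteq> N s" for u s
  proof (induction u)
    case (Cons \<gamma> u)
    have "N ((\<gamma> # u) @ s) \<subseteq> N (u @ s)" using f[OF N_big] N_Cons by simp
    then show ?case using Cons by blast
  qed simp
  have N_disj: "small (N (u @ a # s) \<inter> N (v @ b # s))" if "a \<noteq> b" for u v a b s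
  proof -
    have "small (N (a # s) \<inter> N (b # s))" unfolding N_Cons by (rule f_disj[OF N_big that])
    then show ?thesis by (rule small_subset) (use N_append in blast)
  qed
  have hit: "\<exists>s. length s = n \<and> \<not> small (Y \<inter> N s)" if Y: "\<not> small Y" for Y n
  proof (induction n)
    case 0
    then show ?case using Y N_Nil by simp
  next
    case (Suc n)
    then obtain s where s: "length s = n" "\<not> small (Y \<inter> N s)" by blast
    obtain \<gamma> where \<gamma>: "\<not> small (Y \<inter> N s \<inter> f (length s) (N s) \<gamma>)"
      using f_max[OF N_big _ s(2)] by blast
    have "\<not> small (Y \<inter> N (\<gamma> # s))"
      using \<gamma> small_subset[of "Y \<inter> N (\<gamma> # s)" "Y \<inter> N s \<inter> f (length s) (N s) \<gamma>"] N_Cons by auto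
    then show ?case using s(1) by (intro exI[of _ "\<gamma> # s"]) simp
  qed
  show ?thesis
  \<comment> \<open>\<open>col_le\<close> extends sequences at the end while \<open>N\<close> grows
    at the head, hence \<open>rev\<close>.\<close>
  proof (rule that[of "\<lambda>s. N (rev s)"])
    show "\<not> small (N (rev s))" for s by (rule N_big)
    show "N (rev s) \<subseteq> N (rev t)" if "col_le s t" for s t
    proof -
      obtain u where "s = t @ u" using \<open>col_le s t\<close> unfolding col_le_def by blast
      then show ?thesis using N_append[of "rev u" "rev t"] by simp
    qed
    show "small (N (rev s) \<inter> N (rev t))" if "\<not> col_le s t" "\<not> col_le t s" for s t
    proof -
      obtain p a b s' t' where "s = p @ a # s'" "t = p @ b # t'" "a \<noteq> b"
        by (rule col_incomparable[OF \<open>\<not> col_le s t\<close> \<open>\<not> col_le t s\<close>])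
      then show ?thesis using N_disj[of a b "rev s'" "rev p" "rev t'"] by simp
    qed
    show "\<exists>s. N (rev s) \<subseteq> Y" if Y: "\<not> small Y" for Y
    proof -
      have ZY: "\<not> small (Z Y)" using Z[OF Y] by blast
      obtain u where u: "length u = Suc (k Y)" "\<not> small (Z Y \<inter> N u)" using hit[OF ZY] by blast
      then obtain \<gamma> s where us: "u = \<gamma> # s" "length s = k Y" by (cases u) auto
      then have "N u \<in> D (k Y)" using f[OF N_big] N_Cons by auto
      \<comment> \<open>The second alternative in \<open>D (k Y)\<close> is impossible, since
        \<open>N u\<close> meets \<open>Z Y\<close> in a big set.\<close>
      then obtain Y' where Y': "\<not> small Y'" "k Y' = k Y" "N u \<subseteq> Z Y'"
        using u(2) Y unfolding D_def by (auto simp: Int_commute)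
      have "Y' = Y"
      proof (rule ccontr)
        assume "Y' \<noteq> Y"
        then have "small (Z Y' \<inter> Z Y)" using Z_disj Y'(1,2) Y by blast
        then have "small (Z Y \<inter> N u)" by (rule small_subset) (use Y'(3) in blast)
        then show False using u(2) by blast
      qed
      then have "N (rev (rev u)) \<subseteq> Y" using Y'(3) Z[OF Y] by auto
      then show ?thesis by blast
    qed
  qed
qed

end

section \<open>Dense embeddings and Boolean completions\<close>

definition preorder_on_set :: "'a set \<Rightarrow> ('a \<Rightarrow> 'a \<Rightarrow> bool) \<Rightarrow> bool" where
  "preorder_on_set P le \<longleftrightarrow> (\<forall>p\<in>P. le p p) \<and>
    (\<forall>p\<in>P. \<forall>q\<in>P. \<forall>t\<in>P. le p q \<longrightarrow> le q t \<longrightarrow> le p t)"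

lemma preorder_refl: "preorder_on_set P le \<Longrightarrow> p \<in> P \<Longrightarrow> le p p"
  and preorder_trans: "preorder_on_set P le \<Longrightarrow> p \<in> P \<Longrightarrow> q \<in> P \<Longrightarrow> t \<in> P \<Longrightarrow> le p q \<Longrightarrow> le q t \<Longrightarrow> le p t"
  unfolding preorder_on_set_def by blast+

lemma ro_down: "U \<in> ro P le \<Longrightarrow> p \<in> U \<Longrightarrow> q \<in> P \<Longrightarrow> le q p \<Longrightarrow> preorder_on_set P le \<Longrightarrow> q \<in> U"
  and ro_subset: "U \<in> ro P le \<Longrightarrow> U \<subseteq> P"
  and ro_memI: "U \<in> ro P le \<Longrightarrow> p \<in> P \<Longrightarrow>
    (\<And>q. q \<in> P \<Longrightarrow> le q p \<Longrightarrow> \<exists>t\<in>U. le t q) \<Longrightarrow> p \<in> U"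
proof -
  show sub: "U \<subseteq> P" if "U \<in> ro P le" for U :: "'a set" and P le
    using that unfolding ro_def regular_open_def by blast
  have eq: "U = pos_int P le (pos_cl P le U)" if "U \<in> ro P le" for U :: "'a set" and P le
    using that unfolding ro_def regular_open_def by blast
  show "p \<in> U" if "U \<in> ro P le" "p \<in> P" "\<And>q. q \<in> P \<Longrightarrow> le q p \<Longrightarrow> \<exists>t\<in>U. le t q"
  proof -
    have "p \<in> pos_int P le (pos_cl P le U)"
      using that(2,3) sub[OF that(1)] unfolding pos_int_def pos_cl_def by blast
    then show ?thesis using eq[OF that(1)] by blast
  qed
  show "q \<in> U" if U: "U \<in> ro P le" "p \<in> U" "q \<in> P" "le q p" and pre: "preorder_on_set P le"
  proof -
    have p: "p \<in> pos_int P le (pos_cl P le U)" using eq[OF U(1)] U(2) by blast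
    then have "q \<in> pos_int P le (pos_cl P le U)"
      using U(3,4) preorder_trans[OF pre] unfolding pos_int_def by blast
    then show ?thesis using eq[OF U(1)] by blast
  qed
qed

lemma ro_eqI:
  assumes "U \<subseteq> P" "preorder_on_set P le" "\<And>p q. p \<in> U \<Longrightarrow> q \<in> P \<Longrightarrow> le q p \<Longrightarrow> q \<in> U"
    and "\<And>p. p \<in> P \<Longrightarrow> (\<And>q. q \<in> P \<Longrightarrow> le q p \<Longrightarrow> \<exists>t\<in>U. le t q) \<Longrightarrow> p \<in> U"
  shows "U \<in> ro P le"
proof -
  have "U \<subseteq> pos_int P le (pos_cl P le U)"
    unfolding pos_int_def pos_cl_def
    using assms(1,3) preorder_refl[OF assms(2)] by blast
  moreover have "pos_int P le (pos_cl P le U) \<subseteq> U"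
  proof
    fix p assume p: "p \<in> pos_int P le (pos_cl P le U)"
    show "p \<in> U"
    proof (rule assms(4))
      show "p \<in> P" using p unfolding pos_int_def by blast
      show "\<exists>t\<in>U. le t q" if "q \<in> P" "le q p" for q
        using p that unfolding pos_int_def pos_cl_def by blast
    qed
  qed
  ultimately have "U = pos_int P le (pos_cl P le U)" by (rule equalityI)
  then show ?thesis using assms(1) unfolding ro_def regular_open_def by simp
qed

lemma ba_iso_trans: "ba_iso A B \<Longrightarrow> ba_iso B D \<Longrightarrow> ba_iso A D"
proof -
  assume "ba_iso A B" "ba_iso B D"
  then obtain f g where f: "bij_betw f A B" "\<forall>x\<in>A. \<forall>y\<in>A. x \<subseteq> y \<longleftrightarrow> f x \<subseteq> f y"
    and g: "bij_betw g B D" "\<forall>x\<in>B. \<forall>y\<in>B. x \<subseteq> y \<longleftrightarrow> g x \<subseteq> g y"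
    unfolding ba_iso_def by (elim exE conjE)
  have "bij_betw (g \<circ> f) A D" by (rule bij_betw_trans[OF f(1) g(1)])
  moreover have "x \<subseteq> y \<longleftrightarrow> (g \<circ> f) x \<subseteq> (g \<circ> f) y" if "x \<in> A" "y \<in> A" for x y
    using f(2) g(2) bij_betwE[OF f(1)] that by simp
  ultimately show "ba_iso A D" unfolding ba_iso_def by blast
qed

text \<open>The isomorphism takes preimages under \<open>e\<close>. Density shows that it loses
  nothing, and reflection of compatibility shows that preimages are regular and that every regular
  open set of \<open>Q\<close> arises.\<close>

lemma ro_dense_embedding:
  assumes P: "preorder_on_set P le" and Q: "preorder_on_set Q lq"
    and eP: "\<And>s. s \<in> Q \<Longrightarrow> e s \<in> P"
    and mono: "\<And>s t. s \<in> Q \<Longrightarrow> t \<in> Q \<Longrightarrow> lq s t \<Longrightarrow> le (e s) (e t)"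
    and comp: "\<And>s t. s \<in> Q \<Longrightarrow> t \<in> Q \<Longrightarrow> compat P le (e s) (e t) \<Longrightarrow> compat Q lq s t"
    and dense: "\<And>p. p \<in> P \<Longrightarrow> \<exists>s\<in>Q. le (e s) p"
  shows "ba_iso (ro P le) (ro Q lq)"
proof -
  define f where "f U = {s\<in>Q. e s \<in> U}" for U
  \<comment> \<open>\<open>e\<close> need not reflect the order, but a comparison of values yields a
    common refinement in \<open>Q\<close>.\<close>
  have meet: "\<exists>v\<in>Q. lq v s \<and> lq v t" if "s \<in> Q" "t \<in> Q" "le (e s) (e t)" for s t
    using comp[OF that(1,2)] that(3) eP that(1) preorder_refl[OF P] unfolding compat_def by blast
  have f_ro: "f U \<in> ro Q lq" if U: "U \<in> ro P le" for U
  proof (rule ro_eqI[OF _ Q])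
    show "f U \<subseteq> Q" unfolding f_def by blast
    show "q \<in> f U" if "p \<in> f U" "q \<in> Q" "lq q p" for p q
      using that ro_down[OF U _ eP mono P, of p q] unfolding f_def by blast
    fix s assume s: "s \<in> Q" and *: "\<And>u. u \<in> Q \<Longrightarrow> lq u s \<Longrightarrow> \<exists>v\<in>f U. lq v u"
    have "e s \<in> U"
    proof (rule ro_memI[OF U eP[OF s]])
      fix p assume p: "p \<in> P" "le p (e s)"
      obtain u where u: "u \<in> Q" "le (e u) p" using dense[OF p(1)] by blast
      have "le (e u) (e s)" by (rule preorder_trans[OF P eP[OF u(1)] p(1) eP[OF s] u(2) p(2)])
      then obtain v where v: "v \<in> Q" "lq v u" "lq v s" using meet u(1) s by blast
      obtain w where w: "w \<in> f U" "lq w v" using *[OF v(1,3)] by blast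
      then have wQ: "w \<in> Q" "e w \<in> U" unfolding f_def by blast+
      have "lq w u" by (rule preorder_trans[OF Q wQ(1) v(1) u(1) w(2) v(2)])
      then have "le (e w) (e u)" by (rule mono[OF wQ(1) u(1)])
      then have "le (e w) p" by (rule preorder_trans[OF P eP[OF wQ(1)] eP[OF u(1)] p(1) _ u(2)])
      then show "\<exists>t\<in>U. le t p" using wQ(2) by blast
    qed
    then show "s \<in> f U" using s unfolding f_def by blast
  qed
  have f_le: "U \<subseteq> V" if U: "U \<in> ro P le" and V: "V \<in> ro P le" and sub: "f U \<subseteq> f V" for U V
  proof
    fix p assume p: "p \<in> U"
    then have pP: "p \<in> P" using ro_subset[OF U] by blast
    show "p \<in> V"
    proof (rule ro_memI[OF V pP])
      fix q assume q: "q \<in> P" "le q p"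
      have qU: "q \<in> U" by (rule ro_down[OF U p q P])
      obtain s where s: "s \<in> Q" "le (e s) q" using dense[OF q(1)] by blast
      have "e s \<in> U" by (rule ro_down[OF U qU eP[OF s(1)] s(2) P])
      then have "e s \<in> V" using sub s(1) unfolding f_def by blast
      then show "\<exists>t\<in>V. le t q" using s(2) by blast
    qed
  qed
  have f_surj: "\<exists>U\<in>ro P le. f U = W" if W: "W \<in> ro Q lq" for W
  proof -
    have WQ: "W \<subseteq> Q" by (rule ro_subset[OF W])
    \<comment> \<open>The regularization of the downward closure of the image of
      \<open>W\<close>.\<close>
    define U where "U = {p\<in>P. \<forall>q\<in>P. le q p \<longrightarrow> (\<exists>t\<in>P. le t q \<and> (\<exists>v\<in>W. le t (e v)))}"
    have "U \<in> ro P le"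
    proof (rule ro_eqI[OF _ P])
      show "U \<subseteq> P" unfolding U_def by blast
      show "q \<in> U" if "p \<in> U" "q \<in> P" "le q p" for p q
        using that preorder_trans[OF P] unfolding U_def by blast
      fix p assume p: "p \<in> P" and *: "\<And>q. q \<in> P \<Longrightarrow> le q p \<Longrightarrow> \<exists>t\<in>U. le t q"
      show "p \<in> U" unfolding U_def
      proof (intro CollectI conjI ballI impI p)
        fix q assume q: "q \<in> P" "le q p"
        obtain t where t: "t \<in> U" "le t q" using *[OF q] by blast
        then have tP: "t \<in> P" unfolding U_def by blast
        obtain x where x: "x \<in> P" "le x t" "\<exists>v\<in>W. le x (e v)"
          using t(1) preorder_refl[OF P tP] tP unfolding U_def by blast
        have "le x q" by (rule preorder_trans[OF P x(1) tP q(1) x(2) t(2)])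
        then show "\<exists>t\<in>P. le t q \<and> (\<exists>v\<in>W. le t (e v))" using x by blast
      qed
    qed
    moreover have "f U = W"
    proof
      show "W \<subseteq> f U"
      proof
        fix s assume s: "s \<in> W"
        then have sQ: "s \<in> Q" using WQ by blast
        have "e s \<in> U" unfolding U_def using eP[OF sQ] preorder_refl[OF P] s by blast
        then show "s \<in> f U" using sQ unfolding f_def by blast
      qed
      show "f U \<subseteq> W"
      proof
        fix s assume "s \<in> f U"
        then have s: "s \<in> Q" "e s \<in> U" unfolding f_def by blast+
        show "s \<in> W"
        proof (rule ro_memI[OF W s(1)])
          fix u assume u: "u \<in> Q" "lq u s"
          obtain p v where p: "p \<in> P" "le p (e u)" and v: "v \<in> W" "le p (e v)"
            using s(2) eP[OF u(1)] mono[OF u(1) s(1) u(2)] unfolding U_def by blast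
          obtain w where w: "w \<in> Q" "le (e w) p" using dense[OF p(1)] by blast
          have vQ: "v \<in> Q" using v(1) WQ by blast
          have "le (e w) (e u)" by (rule preorder_trans[OF P eP[OF w(1)] p(1) eP[OF u(1)] w(2) p(2)])
          then obtain x where x: "x \<in> Q" "lq x w" "lq x u" using meet w(1) u(1) by blast
          have "le (e x) (e w)" by (rule mono[OF x(1) w(1) x(2)])
          then have "le (e x) p" by (rule preorder_trans[OF P eP[OF x(1)] eP[OF w(1)] p(1) _ w(2)])
          then have "le (e x) (e v)" by (rule preorder_trans[OF P eP[OF x(1)] p(1) eP[OF vQ] _ v(2)])
          then obtain y where y: "y \<in> Q" "lq y x" "lq y v" using meet x(1) vQ by blast
          have "y \<in> W" by (rule ro_down[OF W v(1) y(1,3) Q])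
          moreover have "lq y u" by (rule preorder_trans[OF Q y(1) x(1) u(1) y(2) x(3)])
          ultimately show "\<exists>t\<in>W. lq t u" by blast
        qed
      qed
    qed
    ultimately show ?thesis by blast
  qed
  have "inj_on f (ro P le)" by (rule inj_onI) (use f_le in blast)
  moreover have "f ` ro P le = ro Q lq" using f_ro f_surj by blast
  ultimately have "bij_betw f (ro P le) (ro Q lq)" unfolding bij_betw_def by blast
  moreover have "U \<subseteq> V \<longleftrightarrow> f U \<subseteq> f V" if "U \<in> ro P le" "V \<in> ro P le" for U V
    using f_le[OF that] unfolding f_def by blast
  ultimately show ?thesis unfolding ba_iso_def by blast
qed

lemma sep_le_preorder:
  assumes "preorder_on_set P le"
  shows "preorder_on_set P (sep_le P le)"
  unfolding preorder_on_set_def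
proof (intro conjI ballI impI)
  fix p assume "p \<in> P"
  then show "sep_le P le p p"
    using preorder_refl[OF assms] unfolding sep_le_def compat_def by blast
next
  fix p q t assume P: "p \<in> P" "q \<in> P" "t \<in> P" and le: "sep_le P le p q" "sep_le P le q t"
  show "sep_le P le p t" unfolding sep_le_def
  proof (intro ballI impI)
    fix r assume r: "r \<in> P" "le r p"
    then obtain x where x: "x \<in> P" "le x r" "le x q" using le(1) unfolding sep_le_def compat_def by blast
    then obtain y where y: "y \<in> P" "le y x" "le y t" using le(2) unfolding sep_le_def compat_def by blast
    have "le y r" by (rule preorder_trans[OF assms y(1) x(1) r(1) y(2) x(2)])
    then show "compat P le r t" using y unfolding compat_def by blast
  qed
qed

text \<open>The quotient map is a dense embedding of \<open>P\<close> into the quotient. It reflects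
  compatibility, because a common separative lower bound becomes a genuine one after two uses of the
  definition.\<close>

lemma ro_separative_quotient:
  assumes P: "preorder_on_set P le"
  shows "ba_iso (ro (sq_carrier P le) (sq_le P le)) (ro P le)"
proof -
  define cl where "cl p = {q \<in> P. sep_le P le p q \<and> sep_le P le q p}" for p
  have S: "preorder_on_set P (sep_le P le)" by (rule sep_le_preorder[OF P])
  have carrier: "sq_carrier P le = cl ` P" unfolding sq_carrier_def cl_def by simp
  have cl_self: "p \<in> cl p" if "p \<in> P" for p
    using that preorder_refl[OF S] unfolding cl_def by blast
  have sq: "sq_le P le (cl p) (cl q) \<longleftrightarrow> sep_le P le p q" if "p \<in> P" "q \<in> P" for p q
  proof
    assume "sq_le P le (cl p) (cl q)"
    then obtain x y where x: "x \<in> P" "sep_le P le p x" and y: "y \<in> P" "sep_le P le y q"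
        and xy: "sep_le P le x y"
      unfolding sq_le_def cl_def by blast
    have "sep_le P le p y" by (rule preorder_trans[OF S that(1) x(1) y(1) x(2) xy])
    then show "sep_le P le p q" by (rule preorder_trans[OF S that(1) y(1) that(2) _ y(2)])
  next
    assume "sep_le P le p q"
    then show "sq_le P le (cl p) (cl q)" using cl_self that unfolding sq_le_def by blast
  qed
  have sep: "sep_le P le p q" if "p \<in> P" "q \<in> P" "le p q" for p q
    using that preorder_refl[OF P] preorder_trans[OF P] unfolding sep_le_def compat_def by blast
  show ?thesis
  proof (rule ro_dense_embedding[OF _ P])
    show "preorder_on_set (sq_carrier P le) (sq_le P le)"
      unfolding preorder_on_set_def carrier
    proof (intro conjI ballI impI)
      fix A assume "A \<in> cl ` P"
      then obtain p where "p \<in> P" "A = cl p" by blast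
      then show "sq_le P le A A" using sq preorder_refl[OF S] by simp
    next
      fix A B D assume ABD: "A \<in> cl ` P" "B \<in> cl ` P" "D \<in> cl ` P"
        and le: "sq_le P le A B" "sq_le P le B D"
      obtain p q t where P: "p \<in> P" "q \<in> P" "t \<in> P" and eq: "A = cl p" "B = cl q" "D = cl t"
        using ABD by blast
      have "sep_le P le p t"
        by (rule preorder_trans[OF S P]) (use le in \<open>simp_all add: eq sq P\<close>)
      then show "sq_le P le A D" by (simp add: eq sq P)
    qed
    show "cl p \<in> sq_carrier P le" if "p \<in> P" for p using that unfolding carrier by blast
    show "sq_le P le (cl p) (cl q)" if "p \<in> P" "q \<in> P" "le p q" for p q
      using sq[OF that(1,2)] sep[OF that] by simp
    show "compat P le p q"
      if pq: "p \<in> P" "q \<in> P" "compat (sq_carrier P le) (sq_le P le) (cl p) (cl q)" for p q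
    proof -
      obtain t where t: "t \<in> P" "sep_le P le t p" "sep_le P le t q"
        using pq unfolding compat_def carrier by (auto simp: sq)
      then obtain x where x: "x \<in> P" "le x t" "le x p"
        using preorder_refl[OF P] unfolding sep_le_def compat_def by blast
      then obtain y where y: "y \<in> P" "le y x" "le y q"
        using t(3) unfolding sep_le_def compat_def by blast
      have "le y p" by (rule preorder_trans[OF P y(1) x(1) pq(1) y(2) x(3)])
      then show ?thesis using y unfolding compat_def by blast
    qed
    show "\<exists>p\<in>P. sq_le P le (cl p) A" if A: "A \<in> sq_carrier P le" for A
    proof -
      obtain p where "p \<in> P" "A = cl p" using A unfolding carrier by blast
      then show ?thesis using sq[of p p] preorder_refl[OF S, of p] by auto
    qed
  qed
qed

section \<open>The filtration of a singular cardinal\<close>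

lemma
  assumes "Well_order p"
  shows wo_refl: "a \<in> Field p \<Longrightarrow> (a, a) \<in> p"
    and wo_trans: "(a, b) \<in> p \<Longrightarrow> (b, c) \<in> p \<Longrightarrow> (a, c) \<in> p"
    and wo_antisym: "(a, b) \<in> p \<Longrightarrow> (b, a) \<in> p \<Longrightarrow> a = b"
    and wo_total: "a \<in> Field p \<Longrightarrow> b \<in> Field p \<Longrightarrow> (a, b) \<in> p \<or> (b, a) \<in> p"
    and wo_least: "D \<subseteq> Field p \<Longrightarrow> D \<noteq> {} \<Longrightarrow> \<exists>m\<in>D. \<forall>d\<in>D. (m, d) \<in> p"
proof -
  interpret wo_rel p using assms by (simp add: wo_rel_def)
  show "a \<in> Field p \<Longrightarrow> (a, a) \<in> p" using REFL by (simp add: refl_on_def)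
  show "(a, b) \<in> p \<Longrightarrow> (b, c) \<in> p \<Longrightarrow> (a, c) \<in> p" using TRANS by (rule transD)
  show "(a, b) \<in> p \<Longrightarrow> (b, a) \<in> p \<Longrightarrow> a = b" using ANTISYM by (rule antisymD)
  show "a \<in> Field p \<Longrightarrow> b \<in> Field p \<Longrightarrow> (a, b) \<in> p \<or> (b, a) \<in> p" using TOTALS by blast
  show "\<exists>m\<in>D. \<forall>d\<in>D. (m, d) \<in> p" if "D \<subseteq> Field p" "D \<noteq> {}"
    using minim_in[OF that] minim_least[OF that(1)] by blast
qed

lemma card_of_under_ordLess:
  assumes "Card_order p" "\<not> finite (Field p)" "a \<in> Field p"
  shows "|under p a| <o p"
proof -
  have p: "|Field p| =o p" by (rule card_of_Field_ordIso[OF assms(1)])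
  have "|underS p a| <o |Field p|"
    by (rule ordLess_ordIso_trans[OF card_of_underS[OF assms(1,3)] ordIso_symmetric[OF p]])
  moreover have "|{a}| <o |Field p|"
    by (rule finite_ordLess_infinite[OF card_of_Well_order card_of_Well_order]) (use assms(2) in \<open>simp_all add: Field_card_of\<close>)
  ultimately have "|underS p a \<union> {a}| <o |Field p|"
    by (rule card_of_Un_ordLess_infinite[OF assms(2)])
  moreover have "|under p a| \<le>o |underS p a \<union> {a}|"
    by (rule card_of_mono1) (auto simp: under_def underS_def)
  ultimately show ?thesis using ordLeq_ordLess_trans ordLess_ordIso_trans[OF _ p] by blast
qed

text \<open>Full cardinality gives order type at least \<open>r\<close>, as cardinals are least
  order types. A longer type would put a copy of \<open>r\<close> inside a proper initial segment of
  \<open>r\<close>, which is too small.\<close>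

lemma Restr_ordIso_iff:
  assumes r: "Card_order r" and A: "A \<subseteq> Field r"
  shows "Restr r A =o r \<longleftrightarrow> |A| =o r"
proof
  have wo: "Well_order r" using r by (rule card_order_on_well_order_on)
  have woA: "well_order_on A (Restr r A)" by (rule well_order_on_Restr[OF wo A])
  have WA: "Well_order (Restr r A)" by (rule Well_order_Restr[OF wo])
  have FA: "Field (Restr r A) = A" using well_order_on_Field[OF woA] ..
  have Fr: "|Field r| =o r" by (rule card_of_Field_ordIso[OF r])
  {
    assume "Restr r A =o r"
    then obtain f where "iso (Restr r A) r f" unfolding ordIso_def by blast
    then have "bij_betw f A (Field r)" unfolding iso_def FA by blast
    then have "|A| =o |Field r|" by (rule card_of_ordIsoI)
    then show "|A| =o r" using Fr by (rule ordIso_transitive)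
  next
    assume *: "|A| =o r"
    have "r \<le>o Restr r A"
      by (rule ordIso_ordLeq_trans[OF ordIso_symmetric[OF *] card_of_least[OF woA]])
    moreover have "Restr r A \<le>o r"
    proof (rule ccontr)
      assume "\<not> Restr r A \<le>o r"
      then have "r <o Restr r A" using not_ordLeq_iff_ordLess[OF wo WA] by blast
      then obtain a where a: "a \<in> A" and "r =o Restr (Restr r A) (underS (Restr r A) a)"
        using ordLess_iff_ordIso_Restr[OF WA wo] FA by auto
      then obtain f where "iso r (Restr (Restr r A) (underS (Restr r A) a)) f"
        unfolding ordIso_def by blast
      then have "bij_betw f (Field r) (Field (Restr (Restr r A) (underS (Restr r A) a)))"
        unfolding iso_def by blast
      then have "|Field r| =o |Field (Restr (Restr r A) (underS (Restr r A) a))|"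
        by (rule card_of_ordIsoI)
      moreover have "|Field (Restr (Restr r A) (underS (Restr r A) a))| \<le>o |underS r a|"
        by (rule card_of_mono1) (auto simp: Field_def underS_def)
      ultimately have "|Field r| \<le>o |underS r a|" by (rule ordIso_ordLeq_trans)
      moreover have "|underS r a| <o |Field r|"
        by (rule ordLess_ordIso_trans[OF card_of_underS[OF r] ordIso_symmetric[OF Fr]])
          (use a A in blast)
      ultimately show False using not_ordLess_ordLeq[of "|underS r a|"] by blast
    qed
    ultimately show "Restr r A =o r" by (simp add: ordIso_iff_ordLeq)
  }
qed

lemma P_omega_kappa_eq:
  fixes r :: "'k rel"
  assumes "card_order r"
  shows "P_omega_kappa r = {A. \<not> small A}"
proof -
  have F: "Field r = UNIV" using card_order_on_Card_order[OF assms] by simp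
  have r: "Card_order r" using assms F by simp
  have U: "|UNIV :: 'k set| =o r" using card_of_Field_ordIso[OF r] F by simp
  have "|A| =o r \<longleftrightarrow> \<not> small A" for A :: "'k set"
  proof
    assume "|A| =o r"
    then have "|UNIV :: 'k set| \<le>o |A|"
      using ordIso_imp_ordLeq[OF ordIso_transitive[OF U ordIso_symmetric]] by blast
    then show "\<not> small A" unfolding small_def using not_ordLess_ordLeq by blast
  next
    assume "\<not> small A"
    then have "|UNIV :: 'k set| \<le>o |A|"
      unfolding small_def using card_not_le_iff[of "UNIV :: 'k set" A] by blast
    moreover have "|A| \<le>o |UNIV :: 'k set|" by (rule card_of_mono1) simp
    ultimately have "|A| =o |UNIV :: 'k set|" by (simp add: ordIso_iff_ordLeq)
    then show "|A| =o r" using U by (rule ordIso_transitive)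
  qed
  then show ?thesis
    unfolding P_omega_kappa_def using Restr_ordIso_iff[OF r] F by simp
qed

text \<open>\<open>C\<close> carries the order of its cardinal and not that of \<open>r\<close>, so
  its initial segments are smaller than cf(\<kappa>). Level \<open>a\<close> collects the initial
  segments of \<kappa> up to the points of \<open>C\<close> that come no later than
  \<open>a\<close>; adding \<open>C\<close> makes every level at least as large as \<open>C\<close>.
  By 2^\<kappa> = \<kappa>^+ the initial segments of the power set have size at most
  \<kappa>.\<close>

lemma singular_filtrationI:
  fixes r :: "'k rel" and C :: "'k set"
  assumes card: "card_order r" and cof: "cof_witness r C"
    and unc: "natLeq <o |C|" and C_less: "|C| <o r"
    and suc: "|UNIV :: 'k set set| =o cardSuc r"
  shows "singular_filtration C (\<lambda>a b. (a, b) \<in> |C| ) (\<lambda>a. C \<union> (\<Union>b\<in>under (card_of C) a. under r b))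
    (\<lambda>x y. (x, y) \<in> |UNIV :: 'k set set| \<and> x \<noteq> y)"
proof -
  define p where "p = |C|"
  define q where "q = |UNIV :: 'k set set|"
  have Fr: "Field r = UNIV" using card_order_on_Card_order[OF card] by simp
  have r: "Card_order r" using card Fr by simp
  have wr: "Well_order r" using r by (rule card_order_on_well_order_on)
  have U: "|UNIV :: 'k set| =o r" using card_of_Field_ordIso[OF r] Fr by simp
  have Fp: "Field p = C" and p: "Card_order p" and wp: "Well_order p"
    unfolding p_def by (rule Field_card_of card_of_Card_order card_of_Well_order)+
  have Fq: "Field q = UNIV" and q: "Card_order q" and wq: "Well_order q"
    unfolding q_def by (rule Field_card_of card_of_Card_order card_of_Well_order)+
  have C_inf: "\<not> finite C"
    using unc ordLess_imp_ordLeq infinite_iff_natLeq_ordLeq by blast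
  then have U_inf: "\<not> finite (UNIV :: 'k set)" using finite_subset[OF subset_UNIV[of C]] by blast
  have cof1: "\<exists>b\<in>C. (a, b) \<in> r" for a
    using cof Fr unfolding cof_witness_def cofinal_def by blast
  \<comment> \<open>A set smaller than \<open>C\<close> is not cofinal, as \<open>C\<close> has
    least cardinality among cofinal sets.\<close>
  have bounded: "\<exists>x. \<forall>d\<in>D. (d, x) \<in> r \<and> (x, d) \<notin> r" if "|D| <o |C|" for D :: "'k set"
  proof -
    have "\<not> |C| \<le>o |D|" by (rule not_ordLess_ordLeq[OF that])
    then have "\<not> cofinal r D" using cof unfolding cof_witness_def by blast
    then obtain x where "\<And>d. d \<in> D \<Longrightarrow> (x, d) \<notin> r" unfolding cofinal_def Fr by blast
    then show ?thesis using wo_total[OF wr] Fr by (metis UNIV_I)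
  qed
  have initial: "|under p a| <o |C|" if "a \<in> C" for a
    using card_of_under_ordLess[OF p] that C_inf Fp unfolding p_def by simp
  have under_small: "|under r x| <o |UNIV :: 'k set|" for x
    using ordLess_ordIso_trans[OF card_of_under_ordLess[OF r] ordIso_symmetric[OF U]] U_inf Fr
    by simp
  have C_small: "|C| <o |UNIV :: 'k set|"
    by (rule ordLess_ordIso_trans[OF C_less ordIso_symmetric[OF U]])
  define F where "F a = C \<union> (\<Union>b\<in>under p a. under r b)" for a
  have "singular_filtration C (\<lambda>a b. (a, b) \<in> p) F (\<lambda>x y. (x, y) \<in> q \<and> x \<noteq> y)"
  proof
    show "(a, a) \<in> p" if "a \<in> C" for a using wo_refl[OF wp] Fp that by blast
    show "(a, c) \<in> p" if "(a, b) \<in> p" "(b, c) \<in> p" for a b c by (rule wo_trans[OF wp that])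
    show "(a, b) \<in> p \<or> (b, a) \<in> p" if "a \<in> C" "b \<in> C" for a b
      by (rule wo_total[OF wp]) (use that Fp in simp_all)
    show "a = b" if "(a, b) \<in> p" "(b, a) \<in> p" for a b by (rule wo_antisym[OF wp that])
    show "\<exists>m\<in>D. \<forall>d\<in>D. (m, d) \<in> p" if "D \<subseteq> C" "D \<noteq> {}" for D
      by (rule wo_least[OF wp]) (use that Fp in simp_all)
    have under_eq: "{b \<in> C. (b, a) \<in> p} = under p a" for a
      using Fp by (auto simp: under_def Field_def)
    show "|{b \<in> C. (b, a) \<in> p}| <o |C|" if "a \<in> C" for a
      unfolding under_eq by (rule initial[OF that])
    show "\<exists>a\<in>C. \<forall>d\<in>D. (d, a) \<in> p" if D: "D \<subseteq> C" "|D| <o |C|" for D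
    proof (rule ccontr)
      assume *: "\<not> ?thesis"
      \<comment> \<open>If \<open>D\<close> were unbounded in \<open>C\<close>, bounds
        \<open>x d\<close> of the elements up to \<open>d\<close> would form a cofinal subset of
        \<kappa> smaller than \<open>C\<close>.\<close>
      have "\<forall>d\<in>D. \<exists>x. \<forall>c\<in>under p d. (c, x) \<in> r"
        using bounded[OF initial] D(1) by blast
      then obtain x where x: "\<And>d c. d \<in> D \<Longrightarrow> c \<in> under p d \<Longrightarrow> (c, x d) \<in> r" by metis
      have "|x ` D| <o |C|" by (rule ordLeq_ordLess_trans[OF card_of_image D(2)])
      then obtain z where z: "\<And>d. d \<in> D \<Longrightarrow> (z, x d) \<notin> r" using bounded by blast
      obtain c where c: "c \<in> C" "(z, c) \<in> r" using cof1 by blast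
      obtain d where d: "d \<in> D" "(d, c) \<notin> p" using * c(1) by blast
      then have "(c, d) \<in> p" using wo_total[OF wp, of c d] c(1) D(1) Fp by blast
      then have "(c, x d) \<in> r" using x[OF d(1)] by (simp add: under_def)
      then have "(z, x d) \<in> r" by (rule wo_trans[OF wr c(2)])
      then show False using z[OF d(1)] by blast
    qed
    show "|UNIV :: nat set| <o |C|"
      by (rule ordIso_ordLess_trans[OF card_of_nat unc])
    show "F a \<subseteq> F b" if "(a, b) \<in> p" for a b
      using wo_trans[OF wp _ that] by (auto simp: F_def under_def)
    show "small (F a)" if aC: "a \<in> C" for a
    proof -
      obtain x where x: "\<And>b. b \<in> under p a \<Longrightarrow> (b, x) \<in> r" using bounded[OF initial[OF aC]] by blast
      have "(\<Union>b\<in>under p a. under r b) \<subseteq> under r x"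
        using wo_trans[OF wr _ x] by (auto simp: under_def)
      then have "|\<Union>b\<in>under p a. under r b| <o |UNIV :: 'k set|"
        by (rule ordLeq_ordLess_trans[OF card_of_mono1 under_small])
      then show ?thesis
        unfolding small_def F_def by (rule card_of_Un_ordLess_infinite[OF U_inf C_small])
    qed
    show "|C| \<le>o |F a|" for a by (rule card_of_mono1) (simp add: F_def)
    show "(\<Union>a\<in>C. F a) = UNIV"
    proof -
      have "y \<in> (\<Union>a\<in>C. F a)" for y
      proof -
        obtain b where b: "b \<in> C" "(y, b) \<in> r" using cof1 by blast
        then have "y \<in> under r b" "b \<in> under p b"
          using wo_refl[OF wp, of b] Fp by (simp_all add: under_def)
        then show ?thesis using b(1) unfolding F_def by blast
      qed
      then show ?thesis by blast
    qed
    have "{(x, y). (x, y) \<in> q \<and> x \<noteq> y} = q - Id" by auto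
    then show "wf {(x, y). (x, y) \<in> q \<and> x \<noteq> y}"
      using wq by (simp add: well_order_on_def)
    show "(x, z) \<in> q \<and> x \<noteq> z" if "(x, y) \<in> q \<and> x \<noteq> y" "(y, z) \<in> q \<and> y \<noteq> z" for x y z
      using that wo_trans[OF wq, of x y z] wo_antisym[OF wq, of x y] by auto
    show "((x, y) \<in> q \<and> x \<noteq> y) \<or> x = y \<or> ((y, x) \<in> q \<and> y \<noteq> x)" for x y
      using wo_total[OF wq, of x y] Fq by auto
    have le_r: "A \<le>o |UNIV :: 'k set|" if "A <o q" "Card_order A" for A :: "'k set rel"
    proof -
      have "A <o cardSuc r" by (rule ordLess_ordIso_trans[OF that(1)]) (use suc q_def in simp)
      then have "A \<le>o r" using cardSuc_ordLeq_ordLess[OF r that(2)] by blast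
      then show ?thesis by (rule ordLeq_ordIso_trans[OF _ ordIso_symmetric[OF U]])
    qed
    have le_under: "|under q y| \<le>o |UNIV :: 'k set|" for y
    proof (rule le_r[OF card_of_under_ordLess[OF q] card_of_Card_order])
      show "\<not> finite (Field q)" using U_inf Finite_Set.finite_set[where 'a = 'k] Fq by simp
    qed (simp add: Fq)
    show "|{x. (x, y) \<in> q \<and> x \<noteq> y}| \<le>o |UNIV :: 'k set|" for y
      by (rule card_le_subset[OF _ le_under[of y]]) (auto simp: under_def)
    show "\<exists>y. \<forall>x\<in>A. (x, y) \<in> q \<and> x \<noteq> y" if A: "|A| \<le>o |UNIV :: 'k set|" for A :: "'k set set"
    proof (rule ccontr)
      assume *: "\<not> ?thesis"
      \<comment> \<open>An unbounded \<open>A\<close> would cover the power set by at most \<kappa>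
        initial segments of size at most \<kappa>.\<close>
      have "UNIV = (\<Union>x\<in>A. under q x)"
        using * wo_total[OF wq] Fq by (auto simp: under_def) (metis UNIV_I wo_refl[OF wq])
      moreover have "|\<Union>x\<in>A. under q x| \<le>o |UNIV :: 'k set|"
        by (rule card_of_UNION_ordLeq_infinite[OF U_inf A]) (use le_under in blast)
      ultimately have "q \<le>o r" unfolding q_def using ordLeq_ordIso_trans[OF _ U] by simp
      moreover have "r <o q"
        by (rule ordLess_ordIso_trans[OF cardSuc_greater[OF r]]) (use suc q_def ordIso_symmetric in auto)
      ultimately show False using not_ordLess_ordLeq by blast
    qed
    show "\<exists>g. (\<forall>c\<in>C. g c \<in> A) \<and> (\<forall>b\<in>C. \<forall>c\<in>C. (b, c) \<in> p \<longrightarrow> b \<noteq> c \<longrightarrow> (g b, g c) \<in> q \<and> g b \<noteq> g c)"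
      if "|C| \<le>o |A|" for A :: "'k set set"
    proof -
      have woA: "well_order_on A (Restr q A)" by (rule well_order_on_Restr[OF wq]) (simp add: Fq)
      \<comment> \<open>A cardinal is a least order type of its size, hence embeds into every
        well-order on a set at least as large.\<close>
      have "p \<le>o Restr q A" unfolding p_def by (rule ordLeq_transitive[OF that card_of_least[OF woA]])
      then obtain g where g: "embed p (Restr q A) g" unfolding ordLeq_def by blast
      have "g c \<in> A" if "c \<in> C" for c
        using embed_in_Field[OF g] that Fp well_order_on_Field[OF woA] by simp
      moreover have "(g b, g c) \<in> q" if "(b, c) \<in> p" for b c
        using embed_compat[OF g] that unfolding BNF_Wellorder_Embedding.compat_def by blast
      moreover have "g b \<noteq> g c" if "b \<in> C" "c \<in> C" "b \<noteq> c" for b c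
        using embed_inj_on[OF wp g] that Fp unfolding inj_on_def by blast
      ultimately show ?thesis by blast
    qed
  qed
  then show ?thesis unfolding p_def q_def F_def .
qed

text \<open>Sequences over the type \<open>'k set\<close>, which has size 2^\<kappa>, represent
  Col(\<omega>, 2^\<kappa>). The map from \<open>dense_tree\<close> embeds them densely into the big
  sets, and passing to the separative quotient preserves the completion up to isomorphism.\<close>

theorem mainTheorem15:
  fixes r :: "'k rel" and C :: "'k set"
  assumes "card_order r"
    and "cof_witness r C"
    and "(card_of (Pow C), r) \<in> ordLess"
    and "(card_of C, card_of (Pow C)) \<in> ordLess"
    and "(natLeq, card_of C) \<in> ordLess"
    and "(card_of (UNIV :: 'k set set), cardSuc r) \<in> ordIso"
  shows "ba_iso (ro (sq_carrier (P_omega_kappa r) (\<subseteq>)) (sq_le (P_omega_kappa r) (\<subseteq>)))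
                (ro (UNIV :: 'k set list set) col_le)"
proof -
  \<comment> \<open>So \<kappa> is singular.\<close>
  have "|C| <o r" by (rule ordLess_transitive[OF assms(4,3)])
  interpret singular_filtration C "\<lambda>a b. (a, b) \<in> |C|" "\<lambda>a. C \<union> (\<Union>b\<in>under (card_of C) a. under r b)"
    "\<lambda>x y. (x, y) \<in> |UNIV :: 'k set set| \<and> x \<noteq> y"
    by (rule singular_filtrationI[OF assms(1,2,5) \<open>|C| <o r\<close> assms(6)])
  have P: "P_omega_kappa r = {A. \<not> small A}" by (rule P_omega_kappa_eq[OF assms(1)])
  have pre: "preorder_on_set (P_omega_kappa r) (\<subseteq>)" unfolding preorder_on_set_def by blast
  obtain e :: "'k set list \<Rightarrow> 'k set" where big: "\<And>s. \<not> small (e s)"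
    and mono: "\<And>s t. col_le s t \<Longrightarrow> e s \<subseteq> e t"
    and disj: "\<And>s t. \<not> col_le s t \<Longrightarrow> \<not> col_le t s \<Longrightarrow> small (e s \<inter> e t)"
    and dense: "\<And>Y. \<not> small Y \<Longrightarrow> \<exists>s. e s \<subseteq> Y"
    using dense_tree by metis
  have col: "preorder_on_set (UNIV :: 'k set list set) col_le"
    unfolding preorder_on_set_def col_le_def by auto
  have "ba_iso (ro (P_omega_kappa r) (\<subseteq>)) (ro (UNIV :: 'k set list set) col_le)"
  proof (rule ro_dense_embedding[OF pre col])
    show "e s \<in> P_omega_kappa r" for s using big P by blast
    show "e s \<subseteq> e t" if "col_le s t" for s t by (rule mono[OF that])
    show "compat UNIV col_le s t" if st: "compat (P_omega_kappa r) (\<subseteq>) (e s) (e t)" for s t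
    proof -
      obtain A where A: "\<not> small A" "A \<subseteq> e s \<inter> e t" using st unfolding compat_def P by blast
      then have "\<not> small (e s \<inter> e t)" using small_subset[OF _ A(2)] by blast
      then have "col_le s t \<or> col_le t s" using disj by blast
      then show ?thesis using preorder_refl[OF col] unfolding compat_def by blast
    qed
    show "\<exists>s\<in>UNIV. e s \<subseteq> Y" if "Y \<in> P_omega_kappa r" for Y using dense that P by blast
  qed
  then show ?thesis by (rule ba_iso_trans[OF ro_separative_quotient[OF pre]])
qed

end
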